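(* Let $E$ be a Banach space. For each $n\ge1$, let $X_{0,n}$ be an $E$-valued random variable and $G_n$ a $C^0_b(E,E)$-valued random variable such that, with probability one, $G_n$ is complete. Let $X_n\in C^1([0,+\infty),E)$ be the unique solution of $\dot X_n(t)=G_n(X_n(t))$, $t\ge0$, $X_n(0)=X_{0,n}$. (i) Suppose that $(X_{0,n},G_n)\to(x_0,g)$ almost surely in $E\times C^0_b(E,E)$, where the limit vector field $g$ is complete. Then $X_n\to x$ almost surely in $C^1([0,+\infty),E)$, where $x$ is the unique solution of $\dot x(t)=g(x(t))$, $t\ge0$, $x(0)=x_0$. (ii) In addition to the assumptions of (i), assume that $x_0$ and $g$ are deterministic, that $\mathcal E$ is a Banach space with $E\subset\mathcal E$ densely and $\|v\|_{\mathcal E}\le\|v\|_E$ for all $v\in E$, that $g\in C^1_{\mathcal E}(E,E)$, and that $$\big(\sqrt n(X_{0,n}-x_0),\ \sqrt n(G_n-g)\big)\xrightarrow{d}(\mathscr X_0,\mathscr G)\quad\text{in }\mathcal E\times C^0_b(E,\mathcal E),$$ where the limit $(\mathscr X_0,\mathscr G)$ is Gaussian. Then $$\sqrt n(X_n-x)\xrightarrow{d}\mathscr X\quad\text{in }C^1([0,+\infty),\mathcal E),$$ where the limit $\mathscr X$ is Gaussian and characterized as the unique solution of $$\dot{\mathscr X}(t)=(\mathrm d_{x(t)}g)(\mathscr X(t))+\mathscr G(x(t)),\quad t\ge0,\qquad\mathscr X(0)=\mathscr X_0.$$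
   Context: For Banach spaces $E,E'$, $C^0_b(E,E')$ is the space of continuous maps $E\to E'$ that are bounded on bounded subsets, with the topology of uniform convergence on bounded sets. $C^1([0,+\infty),E)$ is the space of continuously differentiable functions $[0,+\infty)\to E$ with uniform convergence of functions and derivatives on bounded time sets. A vector field (continuous map $g:E\to E$) is complete if it is locally Lipschitz and the Cauchy problem $\dot x=g(x)$, $x(0)=x_0$ has a unique global solution on $[0,\infty)$ for every $x_0\in E$. $C^1_{\mathcal E}(E,E)$ is the class of functions $f:E\to E$ that are Fréchet differentiable on $E$ and such that: (a) for every $x\in E$, the derivative $\mathrm d_xf:(E,\|\cdot\|_{\mathcal E})\to(E,\|\cdot\|_{\mathcal E})$ is linear and continuous; (b) $x\mapsto\mathrm d_xf$ is continuous from $(E,\|\cdot\|_E)$ to the space of continuous linear operators $(E,\|\cdot\|_{\mathcal E})\to(E,\|\cdot\|_{\mathcal E})$ with the operator norm. By density, each $\mathrm d_xf$ extends uniquely to a continuous linear operator on $\mathcal E$, still denoted $\mathrm d_xf$. *)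

theory Defs
  imports "HOL-Probability.Probability"
begin

section \<open>The space of continuous maps that are bounded on bounded sets\<close>

typedef (overloaded) ('a, 'b) C0b =
  "{f :: 'a::real_normed_vector \<Rightarrow> 'b::real_normed_vector.
      continuous_on UNIV f \<and> (\<forall>B. bounded B \<longrightarrow> bounded (f ` B))}"
  morphisms apply_C0b Abs_C0b
  by (rule exI[of _ "\<lambda>_. 0"]) (auto simp: bounded_iff)

setup_lifting type_definition_C0b

instantiation C0b :: (real_normed_vector, real_normed_vector) real_vector
begin

lift_definition zero_C0b :: "('a, 'b) C0b" is "\<lambda>_. 0"
  by (auto simp: bounded_iff)

lift_definition plus_C0b :: "('a, 'b) C0b \<Rightarrow> ('a, 'b) C0b \<Rightarrow> ('a, 'b) C0b"
  is "\<lambda>f g x. f x + g x"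
  by (auto intro!: continuous_intros bounded_plus_comp)

lift_definition uminus_C0b :: "('a, 'b) C0b \<Rightarrow> ('a, 'b) C0b" is "\<lambda>f x. - f x"
  by (auto intro!: continuous_intros)

lift_definition minus_C0b :: "('a, 'b) C0b \<Rightarrow> ('a, 'b) C0b \<Rightarrow> ('a, 'b) C0b"
  is "\<lambda>f g x. f x - g x"
  by (auto intro!: continuous_intros bounded_minus_comp)

lift_definition scaleR_C0b :: "real \<Rightarrow> ('a, 'b) C0b \<Rightarrow> ('a, 'b) C0b"
  is "\<lambda>c f x. c *\<^sub>R f x"
  by (auto intro!: continuous_intros bounded_scaleR_comp)

instance
  by standard (transfer; force simp: algebra_simps)+

end

instantiation C0b :: (real_normed_vector, real_normed_vector) topological_space
begin

definition open_C0b :: "('a, 'b) C0b set \<Rightarrow> bool"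
  where "open_C0b U \<longleftrightarrow>
    (\<forall>f\<in>U. \<exists>B. bounded B \<and> (\<exists>\<epsilon>>0. \<forall>h.
        (\<forall>x\<in>B. dist (apply_C0b h x) (apply_C0b f x) < \<epsilon>) \<longrightarrow> h \<in> U))"

instance
proof
  show "open (UNIV :: ('a, 'b) C0b set)"
    unfolding open_C0b_def by (auto intro!: exI[of _ "{}"] exI[of _ "1::real"])
next
  fix S T :: "('a, 'b) C0b set"
  assume S: "open S" and T: "open T"
  show "open (S \<inter> T)"
    unfolding open_C0b_def
  proof
    fix f assume f: "f \<in> S \<inter> T"
    obtain B e where B: "bounded B" "e > 0"
      "\<And>h. (\<forall>x\<in>B. dist (apply_C0b h x) (apply_C0b f x) < e) \<Longrightarrow> h \<in> S"
      using S f unfolding open_C0b_def by blast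
    obtain C d where C: "bounded C" "d > 0"
      "\<And>h. (\<forall>x\<in>C. dist (apply_C0b h x) (apply_C0b f x) < d) \<Longrightarrow> h \<in> T"
      using T f unfolding open_C0b_def by blast
    show "\<exists>B. bounded B \<and> (\<exists>\<epsilon>>0. \<forall>h.
        (\<forall>x\<in>B. dist (apply_C0b h x) (apply_C0b f x) < \<epsilon>) \<longrightarrow> h \<in> S \<inter> T)"
      using B C by (intro exI[of _ "B \<union> C"] conjI exI[of _ "min e d"]) auto
  qed
next
  fix K :: "('a, 'b) C0b set set"
  assume "\<forall>S\<in>K. open S"
  then show "open (\<Union>K)"
    unfolding open_C0b_def by - (rule ballI, erule UnionE, drule (1) bspec, drule (1) bspec, blast)
qed

end

lemma tendsto_C0b_iff:
  fixes F :: "'i \<Rightarrow> ('a::real_normed_vector, 'b::real_normed_vector) C0b"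
  shows "(F \<longlongrightarrow> g) net \<longleftrightarrow>
    (\<forall>B. bounded B \<longrightarrow> uniform_limit B (\<lambda>i. apply_C0b (F i)) (apply_C0b g) net)"
proof
  assume lim: "(F \<longlongrightarrow> g) net"
  show "\<forall>B. bounded B \<longrightarrow> uniform_limit B (\<lambda>i. apply_C0b (F i)) (apply_C0b g) net"
  proof (intro allI impI uniform_limitI)
    fix B :: "'a set" and e :: real
    assume B: "bounded B" and e: "e > 0"
    define U where "U = {h. \<exists>d<e. \<forall>x\<in>B. dist (apply_C0b h x) (apply_C0b g x) \<le> d}"
    have "open U"
      unfolding open_C0b_def
    proof
      fix h assume "h \<in> U"
      then obtain d where d: "d < e" "\<And>x. x \<in> B \<Longrightarrow> dist (apply_C0b h x) (apply_C0b g x) \<le> d"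
        unfolding U_def by blast
      show "\<exists>B. bounded B \<and> (\<exists>\<epsilon>>0. \<forall>k.
          (\<forall>x\<in>B. dist (apply_C0b k x) (apply_C0b h x) < \<epsilon>) \<longrightarrow> k \<in> U)"
      proof (intro exI[of _ B] conjI B exI[of _ "(e - d) / 2"] allI impI)
        show "(e - d) / 2 > 0" using d by simp
        fix k assume k: "\<forall>x\<in>B. dist (apply_C0b k x) (apply_C0b h x) < (e - d) / 2"
        have "dist (apply_C0b k x) (apply_C0b g x) \<le> (e + d) / 2" if "x \<in> B" for x
          using k[rule_format, OF that] d(2)[OF that]
            dist_triangle[of "apply_C0b k x" "apply_C0b g x" "apply_C0b h x"]
          by (simp add: field_simps)
        then show "k \<in> U" using d unfolding U_def by (auto intro!: exI[of _ "(e + d) / 2"])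
      qed
    qed
    moreover have "g \<in> U" using e unfolding U_def by (auto intro!: exI[of _ 0])
    ultimately have "\<forall>\<^sub>F i in net. F i \<in> U" using lim by (rule topological_tendstoD[rotated])
    then show "\<forall>\<^sub>F i in net. \<forall>x\<in>B. dist (apply_C0b (F i) x) (apply_C0b g x) < e"
      by eventually_elim (auto simp: U_def)
  qed
next
  assume lim: "\<forall>B. bounded B \<longrightarrow> uniform_limit B (\<lambda>i. apply_C0b (F i)) (apply_C0b g) net"
  show "(F \<longlongrightarrow> g) net"
  proof (rule topological_tendstoI)
    fix U assume "open U" "g \<in> U"
    then obtain B e where "bounded B" "e > 0"
      and U: "\<And>h. (\<forall>x\<in>B. dist (apply_C0b h x) (apply_C0b g x) < e) \<Longrightarrow> h \<in> U"
      unfolding open_C0b_def by blast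
    then have "\<forall>\<^sub>F i in net. \<forall>x\<in>B. dist (apply_C0b (F i) x) (apply_C0b g x) < e"
      using lim uniform_limitD by blast
    then show "\<forall>\<^sub>F i in net. F i \<in> U" by eventually_elim (rule U)
  qed
qed


section \<open>The space of continuously differentiable functions on the half-line\<close>

text \<open>
  A function on \<open>[0, \<infinity>)\<close> is represented by its extension by zero to the negative half-line, so
  that equality of representatives is equality on \<open>[0, \<infinity>)\<close>. Derivatives are taken within
  \<open>[0, \<infinity>)\<close>, hence are one-sided at 0.
\<close>

typedef (overloaded) 'a C1 =
  "{f :: real \<Rightarrow> 'a::real_normed_vector.
      (\<exists>f'. continuous_on {0..} f' \<and>
            (\<forall>t\<ge>0. (f has_vector_derivative f' t) (at t within {0..}))) \<and>
      (\<forall>t<0. f t = 0)}"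
  morphisms apply_C1 Abs_C1
  by (rule exI[of _ "\<lambda>_. 0"]) (auto intro!: exI[of _ "\<lambda>_. 0"])

definition deriv_C1 :: "'a::real_normed_vector C1 \<Rightarrow> real \<Rightarrow> 'a"
  where "deriv_C1 x t = vector_derivative (apply_C1 x) (at t within {0..})"

setup_lifting type_definition_C1

instantiation C1 :: (real_normed_vector) real_vector
begin

lift_definition zero_C1 :: "'a C1" is "\<lambda>_. 0"
  by (auto intro!: exI[of _ "\<lambda>_. 0"])

lift_definition plus_C1 :: "'a C1 \<Rightarrow> 'a C1 \<Rightarrow> 'a C1" is "\<lambda>f g t. f t + g t"
proof (elim CollectE conjE exE, intro CollectI conjI)
  fix f g f' g' :: "real \<Rightarrow> 'a"
  assume "continuous_on {0..} f'" "continuous_on {0..} g'"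
    "\<forall>t\<ge>0. (f has_vector_derivative f' t) (at t within {0..})"
    "\<forall>t\<ge>0. (g has_vector_derivative g' t) (at t within {0..})"
  then show "\<exists>k. continuous_on {0..} k \<and>
      (\<forall>t\<ge>0. ((\<lambda>t. f t + g t) has_vector_derivative k t) (at t within {0..}))"
    by (intro exI[of _ "\<lambda>t. f' t + g' t"]) (simp add: continuous_on_add has_vector_derivative_add)
qed auto

lift_definition uminus_C1 :: "'a C1 \<Rightarrow> 'a C1" is "\<lambda>f t. - f t"
proof (elim CollectE conjE exE, intro CollectI conjI)
  fix f f' :: "real \<Rightarrow> 'a"
  assume "continuous_on {0..} f'"
    "\<forall>t\<ge>0. (f has_vector_derivative f' t) (at t within {0..})"
  then show "\<exists>k. continuous_on {0..} k \<and>
      (\<forall>t\<ge>0. ((\<lambda>t. - f t) has_vector_derivative k t) (at t within {0..}))"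
    by (intro exI[of _ "\<lambda>t. - f' t"]) (simp add: continuous_on_minus has_vector_derivative_minus)
qed auto

lift_definition minus_C1 :: "'a C1 \<Rightarrow> 'a C1 \<Rightarrow> 'a C1" is "\<lambda>f g t. f t - g t"
proof (elim CollectE conjE exE, intro CollectI conjI)
  fix f g f' g' :: "real \<Rightarrow> 'a"
  assume "continuous_on {0..} f'" "continuous_on {0..} g'"
    "\<forall>t\<ge>0. (f has_vector_derivative f' t) (at t within {0..})"
    "\<forall>t\<ge>0. (g has_vector_derivative g' t) (at t within {0..})"
  then show "\<exists>k. continuous_on {0..} k \<and>
      (\<forall>t\<ge>0. ((\<lambda>t. f t - g t) has_vector_derivative k t) (at t within {0..}))"
    by (intro exI[of _ "\<lambda>t. f' t - g' t"]) (simp add: continuous_on_diff has_vector_derivative_diff)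
qed auto

lift_definition scaleR_C1 :: "real \<Rightarrow> 'a C1 \<Rightarrow> 'a C1" is "\<lambda>c f t. c *\<^sub>R f t"
proof (elim CollectE conjE exE, intro CollectI conjI)
  fix f f' :: "real \<Rightarrow> 'a" and c :: real
  assume "continuous_on {0..} f'"
    "\<forall>t\<ge>0. (f has_vector_derivative f' t) (at t within {0..})"
  then show "\<exists>k. continuous_on {0..} k \<and>
      (\<forall>t\<ge>0. ((\<lambda>t. c *\<^sub>R f t) has_vector_derivative k t) (at t within {0..}))"
    by (intro exI[of _ "\<lambda>t. c *\<^sub>R f' t"])
      (simp add: continuous_on_scaleR continuous_on_const
        bounded_linear.has_vector_derivative[OF bounded_linear_scaleR_right])
qed auto

instance
  by standard (transfer; force simp: algebra_simps)+

end

instantiation C1 :: (real_normed_vector) topological_space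
begin

definition open_C1 :: "'a C1 set \<Rightarrow> bool"
  where "open_C1 U \<longleftrightarrow>
    (\<forall>x\<in>U. \<exists>B. bounded B \<and> B \<subseteq> {0..} \<and> (\<exists>\<epsilon>>0. \<forall>y.
        (\<forall>t\<in>B. dist (apply_C1 y t) (apply_C1 x t) < \<epsilon> \<and>
               dist (deriv_C1 y t) (deriv_C1 x t) < \<epsilon>) \<longrightarrow> y \<in> U))"

instance
proof
  show "open (UNIV :: 'a C1 set)"
    unfolding open_C1_def by (auto intro!: exI[of _ "{}"] exI[of _ "1::real"])
next
  fix S T :: "'a C1 set"
  assume S: "open S" and T: "open T"
  show "open (S \<inter> T)"
    unfolding open_C1_def
  proof
    fix x assume x: "x \<in> S \<inter> T"
    obtain B e where B: "bounded B" "B \<subseteq> {0..}" "e > 0"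
      "\<forall>y. (\<forall>t\<in>B. dist (apply_C1 y t) (apply_C1 x t) < e \<and>
                  dist (deriv_C1 y t) (deriv_C1 x t) < e) \<longrightarrow> y \<in> S"
      using S[unfolded open_C1_def, THEN bspec, OF IntD1[OF x]]
      by (elim exE conjE) (rule that; assumption)
    obtain C d where C: "bounded C" "C \<subseteq> {0..}" "d > 0"
      "\<forall>y. (\<forall>t\<in>C. dist (apply_C1 y t) (apply_C1 x t) < d \<and>
                  dist (deriv_C1 y t) (deriv_C1 x t) < d) \<longrightarrow> y \<in> T"
      using T[unfolded open_C1_def, THEN bspec, OF IntD2[OF x]]
      by (elim exE conjE) (rule that; assumption)
    show "\<exists>B. bounded B \<and> B \<subseteq> {0..} \<and> (\<exists>\<epsilon>>0. \<forall>y.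
        (\<forall>t\<in>B. dist (apply_C1 y t) (apply_C1 x t) < \<epsilon> \<and>
               dist (deriv_C1 y t) (deriv_C1 x t) < \<epsilon>) \<longrightarrow> y \<in> S \<inter> T)"
      using B C by (intro exI[of _ "B \<union> C"] conjI exI[of _ "min e d"]) auto
  qed
next
  fix K :: "'a C1 set set"
  assume "\<forall>S\<in>K. open S"
  then show "open (\<Union>K)"
    unfolding open_C1_def by - (rule ballI, erule UnionE, drule (1) bspec, drule (1) bspec, blast)
qed

end

lemma tendsto_C1_iff:
  fixes F :: "'i \<Rightarrow> 'a::real_normed_vector C1"
  shows "(F \<longlongrightarrow> x) net \<longleftrightarrow>
    (\<forall>B. bounded B \<and> B \<subseteq> {0..} \<longrightarrow>
      uniform_limit B (\<lambda>i. apply_C1 (F i)) (apply_C1 x) net \<and>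
      uniform_limit B (\<lambda>i. deriv_C1 (F i)) (deriv_C1 x) net)"
    (is "_ \<longleftrightarrow> ?R")
proof
  assume lim: "(F \<longlongrightarrow> x) net"
  have *: "\<forall>\<^sub>F i in net. \<forall>t\<in>B. dist (apply_C1 (F i) t) (apply_C1 x t) < e \<and>
      dist (deriv_C1 (F i) t) (deriv_C1 x t) < e"
    if B: "bounded B" "B \<subseteq> {0..}" and e: "e > 0" for B e
  proof -
    define U where "U = {y. \<exists>d<e. \<forall>t\<in>B. dist (apply_C1 y t) (apply_C1 x t) \<le> d \<and>
      dist (deriv_C1 y t) (deriv_C1 x t) \<le> d}"
    have "open U"
      unfolding open_C1_def
    proof
      fix y assume "y \<in> U"
      then obtain d where d: "d < e" "\<And>t. t \<in> B \<Longrightarrow> dist (apply_C1 y t) (apply_C1 x t) \<le> d"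
        "\<And>t. t \<in> B \<Longrightarrow> dist (deriv_C1 y t) (deriv_C1 x t) \<le> d"
        unfolding U_def by blast
      show "\<exists>B. bounded B \<and> B \<subseteq> {0..} \<and> (\<exists>\<epsilon>>0. \<forall>z.
          (\<forall>t\<in>B. dist (apply_C1 z t) (apply_C1 y t) < \<epsilon> \<and>
                 dist (deriv_C1 z t) (deriv_C1 y t) < \<epsilon>) \<longrightarrow> z \<in> U)"
      proof (intro exI[of _ B] conjI B exI[of _ "(e - d) / 2"] allI impI)
        show "(e - d) / 2 > 0" using d by simp
        fix z assume z: "\<forall>t\<in>B. dist (apply_C1 z t) (apply_C1 y t) < (e - d) / 2 \<and>
          dist (deriv_C1 z t) (deriv_C1 y t) < (e - d) / 2"
        have "dist (apply_C1 z t) (apply_C1 x t) \<le> (e + d) / 2 \<and>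
            dist (deriv_C1 z t) (deriv_C1 x t) \<le> (e + d) / 2" if "t \<in> B" for t
          using z[rule_format, OF that] d(2,3)[OF that]
            dist_triangle[of "apply_C1 z t" "apply_C1 x t" "apply_C1 y t"]
            dist_triangle[of "deriv_C1 z t" "deriv_C1 x t" "deriv_C1 y t"]
          by (simp add: field_simps)
        then show "z \<in> U" using d unfolding U_def by (auto intro!: exI[of _ "(e + d) / 2"])
      qed
    qed
    moreover have "x \<in> U" using e unfolding U_def by (auto intro!: exI[of _ 0])
    ultimately have "\<forall>\<^sub>F i in net. F i \<in> U" using lim by (rule topological_tendstoD[rotated])
    then show ?thesis by eventually_elim (force simp: U_def)
  qed
  show ?R
  proof (intro allI impI conjI uniform_limitI; elim conjE)
    fix B :: "real set" and e :: real
    assume "bounded B" "B \<subseteq> {0..}" "e > 0"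
    note ev = *[OF this]
    show "\<forall>\<^sub>F i in net. \<forall>t\<in>B. dist (apply_C1 (F i) t) (apply_C1 x t) < e"
      using ev by eventually_elim blast
    show "\<forall>\<^sub>F i in net. \<forall>t\<in>B. dist (deriv_C1 (F i) t) (deriv_C1 x t) < e"
      using ev by eventually_elim blast
  qed
next
  assume lim: ?R
  show "(F \<longlongrightarrow> x) net"
  proof (rule topological_tendstoI)
    fix U assume "open U" "x \<in> U"
    then have "open U" and x: "x \<in> U" by auto
    obtain B e where B: "bounded B" "B \<subseteq> {0..}" and e: "e > 0"
      and U: "\<forall>y. (\<forall>t\<in>B. dist (apply_C1 y t) (apply_C1 x t) < e \<and>
          dist (deriv_C1 y t) (deriv_C1 x t) < e) \<longrightarrow> y \<in> U"
      using \<open>open U\<close>[unfolded open_C1_def, THEN bspec, OF x]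
      by (elim exE conjE) (rule that; assumption)
    have "\<forall>\<^sub>F i in net. \<forall>t\<in>B. dist (apply_C1 (F i) t) (apply_C1 x t) < e"
      "\<forall>\<^sub>F i in net. \<forall>t\<in>B. dist (deriv_C1 (F i) t) (deriv_C1 x t) < e"
      using lim B e by (blast dest: uniform_limitD)+
    then show "\<forall>\<^sub>F i in net. F i \<in> U"
      by eventually_elim (use U in blast)
  qed
qed


section \<open>Complete vector fields\<close>

definition solves :: "('a::real_normed_vector \<Rightarrow> 'a) \<Rightarrow> 'a \<Rightarrow> 'a C1 \<Rightarrow> bool"
  where "solves g x0 x \<longleftrightarrow>
    apply_C1 x 0 = x0 \<and> (\<forall>t\<ge>0. deriv_C1 x t = g (apply_C1 x t))"

definition complete_field :: "('a::real_normed_vector \<Rightarrow> 'a) \<Rightarrow> bool"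
  where "complete_field g \<longleftrightarrow>
    continuous_on UNIV g \<and>
    (\<forall>x. \<exists>u>0. \<exists>L. L-lipschitz_on (cball x u) g) \<and>
    (\<forall>x0. \<exists>!x. solves g x0 x)"


section \<open>Densely embedded spaces\<close>

text \<open>
  The inclusion of \<open>E\<close> in the larger space is an injective linear map \<open>\<iota>\<close> between two types.
\<close>

definition dense_embedding :: "('e::real_normed_vector \<Rightarrow> 'f::real_normed_vector) \<Rightarrow> bool"
  where "dense_embedding \<iota> \<longleftrightarrow>
    linear \<iota> \<and> inj \<iota> \<and> (\<forall>v. norm (\<iota> v) \<le> norm v) \<and> closure (range \<iota>) = UNIV"

lemma dense_embedding_bounded_linear: "dense_embedding \<iota> \<Longrightarrow> bounded_linear \<iota>"
  unfolding dense_embedding_def bounded_linear_def bounded_linear_axioms_def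
  by (auto intro!: exI[of _ 1])

text \<open>
  \<open>E\<close> with the topology of the larger space, and the operator norm of a linear map
  from \<open>E\<close> to \<open>E\<close> when both sides carry the norm of the larger space (cf. \<^const>\<open>onorm\<close>).
\<close>

definition topology_via :: "('e \<Rightarrow> 'f::topological_space) \<Rightarrow> 'e topology"
  where "topology_via \<iota> = pullback_topology UNIV \<iota> euclidean"

definition onorm_via :: "('e \<Rightarrow> 'f::real_normed_vector) \<Rightarrow> ('e \<Rightarrow> 'e) \<Rightarrow> real"
  where "onorm_via \<iota> A = (SUP v. norm (\<iota> (A v)) / norm (\<iota> v))"

definition C1_via ::
    "('e::real_normed_vector \<Rightarrow> 'f::real_normed_vector) \<Rightarrow> ('e \<Rightarrow> 'e) \<Rightarrow> bool"
  where "C1_via \<iota> f \<longleftrightarrow>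
    (\<forall>x. f differentiable (at x)) \<and>
    (\<forall>x. linear (frechet_derivative f (at x)) \<and>
         continuous_map (topology_via \<iota>) (topology_via \<iota>) (frechet_derivative f (at x))) \<and>
    (\<forall>x. ((\<lambda>y. onorm_via \<iota> (\<lambda>v. frechet_derivative f (at y) v - frechet_derivative f (at x) v))
            \<longlongrightarrow> 0) (at x))"

definition extension_via ::
    "('e::real_normed_vector \<Rightarrow> 'f::real_normed_vector) \<Rightarrow> ('e \<Rightarrow> 'e) \<Rightarrow> 'f \<Rightarrow> 'f"
  where "extension_via \<iota> A = (THE A'. bounded_linear A' \<and> (\<forall>v. A' (\<iota> v) = \<iota> (A v)))"

definition C0b_map ::
    "('b::real_normed_vector \<Rightarrow> 'c::real_normed_vector) \<Rightarrow>
     ('a::real_normed_vector, 'b) C0b \<Rightarrow> ('a, 'c) C0b"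
  where "C0b_map \<iota> G = Abs_C0b (\<lambda>x. \<iota> (apply_C0b G x))"

lemma apply_C0b_map:
  assumes "bounded_linear \<iota>"
  shows "apply_C0b (C0b_map \<iota> G) x = \<iota> (apply_C0b G x)"
proof -
  have "(\<lambda>x. \<iota> (apply_C0b G x)) \<in>
      {f. continuous_on UNIV f \<and> (\<forall>B. bounded B \<longrightarrow> bounded (f ` B))}"
    using apply_C0b[of G] bounded_linear_image[OF _ assms]
    by (auto simp: image_image[symmetric] intro!: bounded_linear.continuous_on[OF assms])
  then show ?thesis by (simp add: C0b_map_def Abs_C0b_inverse)
qed

definition C1_map ::
    "('a::real_normed_vector \<Rightarrow> 'b::real_normed_vector) \<Rightarrow> 'a C1 \<Rightarrow> 'b C1"
  where "C1_map \<iota> x = Abs_C1 (\<lambda>t. \<iota> (apply_C1 x t))"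

lemma apply_C1_map:
  assumes "bounded_linear \<iota>"
  shows "apply_C1 (C1_map \<iota> x) t = \<iota> (apply_C1 x t)"
proof -
  obtain f' where "continuous_on {0..} f'"
    "\<forall>t\<ge>0. (apply_C1 x has_vector_derivative f' t) (at t within {0..})"
    "\<forall>t<0. apply_C1 x t = 0"
    using apply_C1[of x] by blast
  then have "(\<lambda>t. \<iota> (apply_C1 x t)) \<in> {f.
      (\<exists>f'. continuous_on {0..} f' \<and>
            (\<forall>t\<ge>0. (f has_vector_derivative f' t) (at t within {0..}))) \<and>
      (\<forall>t<0. f t = 0)}"
    using assms
    by (intro CollectI conjI exI[of _ "\<lambda>t. \<iota> (f' t)"] allI impI)
      (simp_all add: bounded_linear.continuous_on bounded_linear.has_vector_derivative
        linear_0 bounded_linear.linear)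
  then show ?thesis by (simp add: C1_map_def Abs_C1_inverse)
qed


section \<open>Random variables\<close>

text \<open>
  Random variables with values in a topological space are Borel measurable maps; the Borel
  \<open>\<sigma>\<close>-algebra of a product is that of the product topology.
\<close>

definition converges_in_distribution ::
    "'w measure \<Rightarrow> (nat \<Rightarrow> 'w \<Rightarrow> 's::topological_space) \<Rightarrow> 'v measure \<Rightarrow> ('v \<Rightarrow> 's) \<Rightarrow> bool"
  where "converges_in_distribution M Y N Z \<longleftrightarrow>
    (\<forall>n. Y n \<in> borel_measurable M) \<and> Z \<in> borel_measurable N \<and>
    (\<forall>f :: 's \<Rightarrow> real. continuous_on UNIV f \<and> bounded (range f) \<longrightarrow>
       (\<lambda>n. \<integral>\<omega>. f (Y n \<omega>) \<partial>M) \<longlonglongrightarrow> (\<integral>\<omega>. f (Z \<omega>) \<partial>N))"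

text \<open>Gaussian laws may be degenerate and need not be centred.\<close>

definition gaussian_real :: "'v measure \<Rightarrow> ('v \<Rightarrow> real) \<Rightarrow> bool"
  where "gaussian_real N Z \<longleftrightarrow>
    (\<exists>a. AE \<omega> in N. Z \<omega> = a) \<or>
    (\<exists>\<mu> \<sigma>. \<sigma> > 0 \<and> distributed N lborel Z (normal_density \<mu> \<sigma>))"

definition gaussian :: "'v measure \<Rightarrow> ('v \<Rightarrow> 's::{real_vector, topological_space}) \<Rightarrow> bool"
  where "gaussian N Z \<longleftrightarrow>
    Z \<in> borel_measurable N \<and>
    (\<forall>l :: 's \<Rightarrow> real. linear l \<and> continuous_on UNIV l \<longrightarrow> gaussian_real N (\<lambda>\<omega>. l (Z \<omega>)))"


section \<open>The linearised equation\<close>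

definition solves_linearised ::
    "('e::real_normed_vector \<Rightarrow> 'f::real_normed_vector) \<Rightarrow> ('e \<Rightarrow> 'e) \<Rightarrow> 'e C1 \<Rightarrow>
     'f \<Rightarrow> ('e, 'f) C0b \<Rightarrow> 'f C1 \<Rightarrow> bool"
  where "solves_linearised \<iota> g x y0 H y \<longleftrightarrow>
    apply_C1 y 0 = y0 \<and>
    (\<forall>t\<ge>0. deriv_C1 y t =
       extension_via \<iota> (frechet_derivative g (at (apply_C1 x t))) (apply_C1 y t) +
       apply_C0b H (apply_C1 x t))"

end

theory Submission
  imports Defs
begin

text \<open>
  The limit theorems are statements about the solution map, which sends an initial value and a
  vector field to a path; all probability is transported through it.

  For the first part this map is continuous at complete fields. The limit field is Lipschitz in a
  tube around each compact piece of the limit trajectory, so a Gronwall estimate shows that paths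
  driven by nearby data never leave the tube and stay uniformly close to the limit
  (\<open>flow_stable\<close>). Almost sure convergence follows pointwise.

  For the second part the map is differentiable along the given fluctuations. Put
  \<open>Y = c (X - x)\<close> for a path \<open>X\<close> driven by a field \<open>G\<close>. Its derivative splits into the fluctuation
  \<open>c (G - g)\<close> evaluated along \<open>X\<close> and the increment \<open>c (g(X) - g(x))\<close>; by the mean value
  inequality in the larger space the latter is the derivative of \<open>g\<close> at \<open>x\<close>, applied to \<open>Y\<close>, up to
  an error that is small relative to \<open>Y\<close>. Hence \<open>Y\<close> solves the linearised equation up to such an
  error, and a second Gronwall estimate gives convergence to its solution \<open>\<Psi>(Z)\<close>, where \<open>Z\<close> is the
  limit of the fluctuations of the data (\<open>flow_first_order\<close>). The map \<open>\<Psi>\<close> is linear and continuous,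
  so it preserves Gaussian laws.

  What remains is to pass from this deterministic limit to convergence in distribution. The spaces
  need not be separable, and convergence in distribution then gives no almost surely convergent
  copies of the data. The substitute for them is a sup-convolution: for bounded continuous \<open>f\<close>, the
  supremum of \<open>f(y) - k d\<^sub>k(z, w)\<close> over all \<open>w\<close> and all paths \<open>y\<close> compatible with the data fluctuation
  \<open>w\<close> is continuous in \<open>z\<close>, dominates \<open>f(Y)\<close> up to events of vanishing probability, and by the
  deterministic limit tends to at most \<open>f(\<Psi>(z))\<close> as \<open>k\<close> grows (\<open>upper_envelopes\<close>). Weak convergence of
  the data applied to these envelopes and to those of \<open>-f\<close> bounds the expectations of \<open>f(Y)\<close> from
  both sides (\<open>extended_continuous_mapping\<close>).
\<close>

section \<open>Continuously differentiable paths\<close>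

lemma at_within_Ici_not_bot: "t \<ge> 0 \<Longrightarrow> at t within {0::real..} \<noteq> bot"
proof -
  assume "t \<ge> 0"
  then have "at_right t \<le> at t within {0..}" by (intro at_le) auto
  then show ?thesis using trivial_limit_at_right_real[of t] bot.extremum_uniqueI by fastforce
qed

lemma deriv_C1_eqI:
  assumes "t \<ge> 0" "(apply_C1 x has_vector_derivative d) (at t within {0..})"
  shows "deriv_C1 x t = d"
  unfolding deriv_C1_def
  using assms by (intro vector_derivative_within at_within_Ici_not_bot)

lemma C1_continuously_differentiable:
  obtains f' where "continuous_on {0..} f'"
    "\<And>t. t \<ge> 0 \<Longrightarrow> (apply_C1 x has_vector_derivative f' t) (at t within {0..})"
    "\<And>t. t \<ge> 0 \<Longrightarrow> deriv_C1 x t = f' t"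
  using apply_C1[of x] deriv_C1_eqI by blast

lemma C1_has_vector_derivative:
  "t \<ge> 0 \<Longrightarrow> (apply_C1 x has_vector_derivative deriv_C1 x t) (at t within {0..})"
  by (metis C1_continuously_differentiable)

lemma continuous_on_apply_C1: "continuous_on {0..} (apply_C1 x)"
  by (meson C1_has_vector_derivative atLeast_iff continuous_on_eq_continuous_within
      has_vector_derivative_continuous)

lemma C1_eqI:
  assumes "\<And>t. t \<ge> 0 \<Longrightarrow> apply_C1 x t = apply_C1 y t"
  shows "x = y"
proof -
  have "apply_C1 x t = apply_C1 y t" for t
    using assms[of t] apply_C1[of x] apply_C1[of y] by (cases "t < 0") auto
  then show ?thesis by (metis apply_C1_inverse ext)
qed

text \<open>
  Elements of the path space vanish on the negative half-line, so a path has to be cut off at zero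
  before it is abstracted; one-sided derivatives at zero do not see the cut.
\<close>

lemma C1_exI:
  fixes f :: "real \<Rightarrow> 'a::real_normed_vector"
  assumes "continuous_on {0..} f'"
    and "\<And>t. t \<ge> 0 \<Longrightarrow> (f has_vector_derivative f' t) (at t within {0..})"
  obtains x where "\<And>t. t \<ge> 0 \<Longrightarrow> apply_C1 x t = f t" "\<And>t. t \<ge> 0 \<Longrightarrow> deriv_C1 x t = f' t"
proof -
  define h where "h t = (if t < 0 then 0 else f t)" for t
  have d: "(h has_vector_derivative f' t) (at t within {0..})" if "t \<ge> 0" for t
    by (rule has_vector_derivative_transform[OF _ _ assms(2)[OF that]]) (use that in \<open>auto simp: h_def\<close>)
  then have "apply_C1 (Abs_C1 h) = h"
    using assms(1) by (intro Abs_C1_inverse) (auto simp: h_def)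
  then show thesis
    using d by (intro that[of "Abs_C1 h"]) (auto simp: h_def intro!: deriv_C1_eqI)
qed

lemma apply_C1_simps [simp]:
  "apply_C1 (x + y) t = apply_C1 x t + apply_C1 y t"
  "apply_C1 (x - y) t = apply_C1 x t - apply_C1 y t"
  "apply_C1 (c *\<^sub>R x) t = c *\<^sub>R apply_C1 x t"
  by (simp_all add: plus_C1.rep_eq minus_C1.rep_eq scaleR_C1.rep_eq)

lemma apply_C0b_simps [simp]:
  "apply_C0b (g + h) p = apply_C0b g p + apply_C0b h p"
  "apply_C0b (g - h) p = apply_C0b g p - apply_C0b h p"
  "apply_C0b (c *\<^sub>R g) p = c *\<^sub>R apply_C0b g p"
  by (simp_all add: plus_C0b.rep_eq minus_C0b.rep_eq scaleR_C0b.rep_eq)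

lemma deriv_C1_add: "t \<ge> 0 \<Longrightarrow> deriv_C1 (x + y) t = deriv_C1 x t + deriv_C1 y t"
  by (rule deriv_C1_eqI)
    (auto simp: plus_C1.rep_eq intro!: has_vector_derivative_add C1_has_vector_derivative)

lemma deriv_C1_diff: "t \<ge> 0 \<Longrightarrow> deriv_C1 (x - y) t = deriv_C1 x t - deriv_C1 y t"
  by (rule deriv_C1_eqI)
    (auto simp: minus_C1.rep_eq intro!: has_vector_derivative_diff C1_has_vector_derivative)

lemma deriv_C1_scaleR: "t \<ge> 0 \<Longrightarrow> deriv_C1 (c *\<^sub>R x) t = c *\<^sub>R deriv_C1 x t"
  by (rule deriv_C1_eqI)
    (auto simp: scaleR_C1.rep_eq intro!: C1_has_vector_derivative
      bounded_linear.has_vector_derivative[OF bounded_linear_scaleR_right])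

lemma deriv_C1_map:
  assumes "bounded_linear \<iota>" "t \<ge> 0"
  shows "deriv_C1 (C1_map \<iota> x) t = \<iota> (deriv_C1 x t)"
proof (rule deriv_C1_eqI[OF assms(2)])
  have "((\<lambda>t. \<iota> (apply_C1 x t)) has_vector_derivative \<iota> (deriv_C1 x t)) (at t within {0..})"
    by (rule bounded_linear.has_vector_derivative[OF assms(1) C1_has_vector_derivative[OF assms(2)]])
  moreover have "apply_C1 (C1_map \<iota> x) = (\<lambda>t. \<iota> (apply_C1 x t))"
    using apply_C1_map[OF assms(1)] by (rule ext)
  ultimately show "(apply_C1 (C1_map \<iota> x) has_vector_derivative \<iota> (deriv_C1 x t)) (at t within {0..})"
    by simp
qed

lemma tendsto_C1I:
  fixes F :: "'i \<Rightarrow> 'a::real_normed_vector C1"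
  assumes "\<And>T e. T > 0 \<Longrightarrow> e > 0 \<Longrightarrow> \<forall>\<^sub>F i in net. \<forall>t\<in>{0..T}.
    norm (apply_C1 (F i) t - apply_C1 x t) < e \<and> norm (deriv_C1 (F i) t - deriv_C1 x t) < e"
  shows "(F \<longlongrightarrow> x) net"
  unfolding tendsto_C1_iff
proof (intro allI impI conjI uniform_limitI; elim conjE)
  fix B :: "real set" and e :: real
  assume "bounded B" "B \<subseteq> {0..}" and e: "e > 0"
  then obtain T where T: "T > 0" "B \<subseteq> {0..T}"
    unfolding bounded_pos by (auto simp: subset_iff)
  note ev = assms[OF T(1) e]
  show "\<forall>\<^sub>F i in net. \<forall>t\<in>B. dist (apply_C1 (F i) t) (apply_C1 x t) < e"
    using ev by eventually_elim (use T in \<open>auto simp: dist_norm\<close>)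
  show "\<forall>\<^sub>F i in net. \<forall>t\<in>B. dist (deriv_C1 (F i) t) (deriv_C1 x t) < e"
    using ev by eventually_elim (use T in \<open>auto simp: dist_norm\<close>)
qed

lemma tendsto_C1D:
  fixes F :: "'i \<Rightarrow> 'a::real_normed_vector C1"
  assumes "(F \<longlongrightarrow> x) net" "e > 0"
  shows "\<forall>\<^sub>F i in net. \<forall>t\<in>{0..T}.
    norm (apply_C1 (F i) t - apply_C1 x t) < e \<and> norm (deriv_C1 (F i) t - deriv_C1 x t) < e"
proof -
  have "uniform_limit {0..T} (\<lambda>i. apply_C1 (F i)) (apply_C1 x) net"
    "uniform_limit {0..T} (\<lambda>i. deriv_C1 (F i)) (deriv_C1 x) net"
    using assms(1) unfolding tendsto_C1_iff by auto
  from uniform_limitD[OF this(1) assms(2)] uniform_limitD[OF this(2) assms(2)] show ?thesis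
    by eventually_elim (auto simp: dist_norm)
qed

lemma scaled_C1_map_diff_tendsto:
  assumes \<iota>: "bounded_linear \<iota>" and F: "(F \<longlongrightarrow> y) net"
  shows "((\<lambda>i. c *\<^sub>R C1_map \<iota> (F i - x)) \<longlongrightarrow> c *\<^sub>R C1_map \<iota> (y - x)) net"
proof (rule tendsto_C1I)
  fix T e :: real
  assume "T > 0" and e: "e > 0"
  interpret bounded_linear \<iota> by (rule \<iota>)
  obtain K where K: "K > 0" "\<And>v. norm (\<iota> v) \<le> norm v * K"
    using pos_bounded by blast
  define d where "d = e / ((\<bar>c\<bar> + 1) * K)"
  have d: "d > 0" using e K by (simp add: d_def)
  have small: "norm (c *\<^sub>R \<iota> (u - v)) < e" if "norm (u - v) < d" for u v
  proof -
    have "norm (c *\<^sub>R \<iota> (u - v)) \<le> (\<bar>c\<bar> + 1) * (norm (u - v) * K)"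
      unfolding norm_scaleR using K(2)[of "u - v"] by (intro mult_mono) auto
    also have "\<dots> < (\<bar>c\<bar> + 1) * (d * K)"
      using that K(1) by (intro mult_strict_left_mono mult_strict_right_mono) auto
    also have "\<dots> = e" using K(1) by (simp add: d_def)
    finally show ?thesis .
  qed
  from tendsto_C1D[OF F d, of T]
  show "\<forall>\<^sub>F i in net. \<forall>t\<in>{0..T}.
    norm (apply_C1 (c *\<^sub>R C1_map \<iota> (F i - x)) t - apply_C1 (c *\<^sub>R C1_map \<iota> (y - x)) t) < e \<and>
    norm (deriv_C1 (c *\<^sub>R C1_map \<iota> (F i - x)) t - deriv_C1 (c *\<^sub>R C1_map \<iota> (y - x)) t) < e"
    by eventually_elim
      (use small in \<open>auto simp: apply_C1_map[OF \<iota>] deriv_C1_scaleR deriv_C1_map[OF \<iota>] deriv_C1_diff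
        simp flip: scaleR_diff_right diff\<close>)
qed

section \<open>Gronwall's inequality\<close>

text \<open>
  The norm of \<open>z\<close> need not be differentiable, but it is dominated by \<open>v(t) = |z(0)| + \<integral>\<^sub>0\<^sup>t (L |z| + c)\<close>,
  which is, and \<open>v\<close> satisfies the same differential inequality; so \<open>v(t) exp (-L t) - c t\<close> decreases.
\<close>

lemma gronwall_vector_derivative:
  fixes z :: "real \<Rightarrow> 'a::banach"
  assumes T: "0 \<le> T" and L: "0 \<le> L" and c: "0 \<le> c"
    and d: "\<And>t. t \<in> {0..T} \<Longrightarrow> (z has_vector_derivative z' t) (at t within {0..T})"
    and bound: "\<And>t. t \<in> {0..T} \<Longrightarrow> norm (z' t) \<le> L * norm (z t) + c"
  shows "norm (z T) \<le> (norm (z 0) + c * T) * exp (L * T)"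
proof -
  have cont: "continuous_on {0..T} z"
    using d by (meson continuous_on_eq_continuous_within has_vector_derivative_continuous)
  define u where "u t = L * norm (z t) + c" for t
  have cu: "continuous_on {0..T} u" unfolding u_def by (intro continuous_intros cont)
  define v where "v t = norm (z 0) + integral {0..t} u" for t
  have zv: "norm (z t) \<le> v t" if t: "t \<in> {0..T}" for t
  proof -
    have int: "(z' has_integral (z t - z 0)) {0..t}"
      using t by (intro fundamental_theorem_of_calculus)
        (auto intro: has_vector_derivative_within_subset[OF d])
    have "norm (integral {0..t} z') \<le> integral {0..t} u"
      by (rule Henstock_Kurzweil_Integration.integral_norm_bound_integral)
        (use int t bound in \<open>auto simp: u_def[symmetric] has_integral_integrable
          intro!: integrable_continuous_real continuous_on_subset[OF cu]\<close>)
    then show ?thesis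
      using integral_unique[OF int] norm_triangle_sub[of "z t" "z 0"] by (simp add: v_def)
  qed
  have dv: "(v has_vector_derivative u t) (at t within {0..T})" if "t \<in> {0..T}" for t
    unfolding v_def
    by (rule has_vector_derivative_eq_rhs, rule has_vector_derivative_add,
        rule has_vector_derivative_const, rule integral_has_vector_derivative[OF cu that]) simp
  define w where "w t = v t * exp (- L * t) - c * t" for t
  have dw: "(w has_real_derivative (u t * exp (- L * t) - L * v t * exp (- L * t) - c))
      (at t within {0..T})" if "t \<in> {0..T}" for t
    unfolding w_def using dv[OF that, unfolded has_real_derivative_iff_has_vector_derivative[symmetric]]
    by (auto intro!: derivative_eq_intros simp: algebra_simps)
  have neg: "u t * exp (- L * t) - L * v t * exp (- L * t) - c \<le> 0" if t: "t \<in> {0..T}" for t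
  proof -
    have "u t \<le> L * v t + c" unfolding u_def using zv[OF t] L by (simp add: mult_left_mono)
    then have "u t * exp (- L * t) \<le> (L * v t + c) * exp (- L * t)"
      by (intro mult_right_mono) auto
    moreover have "c * exp (- L * t) \<le> c * 1"
      using L t c by (intro mult_left_mono) auto
    ultimately show ?thesis by (simp add: algebra_simps)
  qed
  have "w T \<le> w 0"
  proof (rule DERIV_nonpos_imp_decreasing_open[OF T])
    fix t assume t: "0 < t" "t < T"
    show "\<exists>y. (w has_real_derivative y) (at t) \<and> y \<le> 0"
      using dw[of t] neg[of t] t at_within_Icc_at[of 0 t T] by auto
  next
    show "continuous_on {0..T} w"
      using dw by (meson DERIV_continuous continuous_on_eq_continuous_within)
  qed
  then have "v T * exp (- L * T) \<le> norm (z 0) + c * T" by (simp add: w_def v_def)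
  then have "v T \<le> (norm (z 0) + c * T) * exp (L * T)"
    by (simp add: exp_minus field_simps)
  then show ?thesis using zv[of T] T by simp
qed

section \<open>Uniformity near compact sets\<close>

text \<open>
  Continuity on the whole space is uniform at the points of a compact set even when the second
  argument leaves the set. A bounded set of an infinite-dimensional space is not compact, so this
  is the only uniformity available along a trajectory.
\<close>

lemma continuous_uniformly_near_compact:
  fixes f :: "'a::metric_space \<Rightarrow> 'b::metric_space"
  assumes "continuous_on UNIV f" "compact C" "e > 0"
  obtains d where "d > 0" "\<And>p q. p \<in> C \<Longrightarrow> dist q p < d \<Longrightarrow> dist (f q) (f p) < e"
proof -
  define \<G> where "\<G> = range (\<lambda>c. f -` ball (f c) (e / 2))"
  have "c \<in> f -` ball (f c) (e / 2)" for c
    using assms(3) by simp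
  then have "C \<subseteq> \<Union>\<G>" unfolding \<G>_def by blast
  moreover have "\<And>U. U \<in> \<G> \<Longrightarrow> open U"
    unfolding \<G>_def using assms(1) by (auto intro: open_vimage)
  ultimately obtain d where d: "d > 0" "\<And>p. p \<in> C \<Longrightarrow> \<exists>U\<in>\<G>. ball p d \<subseteq> U"
    using Heine_Borel_lemma[OF assms(2)] by metis
  have "dist (f q) (f p) < e" if pq: "p \<in> C" "dist q p < d" for p q
  proof -
    obtain c where "ball p d \<subseteq> f -` ball (f c) (e / 2)"
      using d(2)[OF pq(1)] unfolding \<G>_def by auto
    moreover have "p \<in> ball p d" "q \<in> ball p d" using d pq by (auto simp: dist_commute)
    ultimately have "p \<in> f -` ball (f c) (e / 2)" "q \<in> f -` ball (f c) (e / 2)" by blast+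
    then have "dist (f c) (f p) < e / 2" "dist (f c) (f q) < e / 2" by simp_all
    then show ?thesis by (metis dist_commute dist_triangle_half_r)
  qed
  with d(1) show thesis by (rule that)
qed

text \<open>
  The sets on which \<open>f\<close> is \<open>m\<close>-Lipschitz have unions increasing in \<open>m\<close>, so by compactness one
  constant serves the whole of \<open>C\<close>; a Lebesgue number of the corresponding cover is the radius \<open>d\<close>.
\<close>

lemma lipschitz_near_compact:
  fixes f :: "'a::metric_space \<Rightarrow> 'b::metric_space"
  assumes lip: "\<And>x. \<exists>u>0. \<exists>L. L-lipschitz_on (cball x u) f" and C: "compact C"
  obtains d L where "d > 0" "L \<ge> 0"
    "\<And>p q. p \<in> C \<Longrightarrow> dist q p < d \<Longrightarrow> dist (f q) (f p) \<le> L * dist q p"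
proof -
  define U where "U m = \<Union>{V. open V \<and> (real m)-lipschitz_on V f}" for m
  have "C \<subseteq> \<Union>(range U)"
  proof
    fix x
    obtain u L where u: "u > 0" "L-lipschitz_on (cball x u) f" using lip by blast
    obtain m where "L \<le> real m" using real_arch_simple by blast
    then have "(real m)-lipschitz_on (ball x u) f"
      using u(2) by (meson ball_subset_cball lipschitz_on_le lipschitz_on_subset)
    then have "x \<in> U m" unfolding U_def using u(1) by (auto intro!: exI[of _ "ball x u"])
    then show "x \<in> \<Union>(range U)" by blast
  qed
  moreover have "open V" if "V \<in> range U" for V using that by (auto simp: U_def)
  ultimately obtain \<F> where \<F>: "\<F> \<subseteq> range U" "finite \<F>" "C \<subseteq> \<Union>\<F>"
    using compactE[OF C] by metis
  then obtain I where I: "finite I" "\<F> = U ` I" by (meson finite_subset_image)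
  define m where "m = Max (insert 0 I)"
  have mono: "U i \<subseteq> U m" if "i \<in> I" for i
  proof -
    have "i \<le> m" using that I(1) by (simp add: m_def)
    then show ?thesis unfolding U_def by (auto intro: lipschitz_on_le) (meson lipschitz_on_le of_nat_mono)
  qed
  then have "C \<subseteq> \<Union>{V. open V \<and> (real m)-lipschitz_on V f}"
    using \<F>(3) I(2) unfolding U_def[symmetric] by blast
  from Heine_Borel_lemma[OF C this] obtain d where d: "d > 0"
    "\<And>p. p \<in> C \<Longrightarrow> \<exists>V\<in>{V. open V \<and> (real m)-lipschitz_on V f}. ball p d \<subseteq> V" by auto
  show thesis
  proof (rule that[OF d(1), of "real m"])
    fix p q assume pq: "p \<in> C" "dist q p < d"
    then obtain V where V: "(real m)-lipschitz_on V f" "ball p d \<subseteq> V" using d(2) by blast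
    have "p \<in> V" "q \<in> V" using V(2) pq d(1) by (auto simp: dist_commute subset_iff)
    then show "dist (f q) (f p) \<le> real m * dist q p" using V(1) lipschitz_onD by blast
  qed simp
qed

lemma compact_path: "compact (apply_C1 x ` {0..T})"
  by (intro compact_continuous_image continuous_on_subset[OF continuous_on_apply_C1]) auto

lemma bounded_tube:
  fixes C :: "'a::real_normed_vector set"
  assumes "bounded C"
  shows "bounded {q. \<exists>p\<in>C. dist q p \<le> d}"
proof -
  obtain R where R: "\<And>p. p \<in> C \<Longrightarrow> norm p \<le> R"
    using assms unfolding bounded_iff by blast
  show ?thesis
  proof (rule boundedI)
    fix q assume "q \<in> {q. \<exists>p\<in>C. dist q p \<le> d}"
    then obtain p where p: "p \<in> C" "dist q p \<le> d" by auto
    then show "norm q \<le> R + d"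
      using R[OF p(1)] norm_triangle_sub[of q p] by (simp add: dist_norm)
  qed
qed

section \<open>Stability of the flow\<close>

text \<open>
  The growth bound is known only as long as the path is in the ball of radius \<open>d\<close>, but it then keeps
  the path strictly inside, so a first time at which the norm reaches \<open>d\<close> cannot exist.
\<close>

lemma gronwall_C1_bootstrap:
  fixes z :: "'a::banach C1"
  assumes L: "0 \<le> L" and c: "0 \<le> c"
    and bound: "\<And>t. t \<in> {0..T} \<Longrightarrow> norm (apply_C1 z t) \<le> d \<Longrightarrow>
      norm (deriv_C1 z t) \<le> L * norm (apply_C1 z t) + c"
    and small: "(norm (apply_C1 z 0) + c * T) * exp (L * T) < d"
    and t: "t \<in> {0..T}"
  shows "norm (apply_C1 z t) \<le> (norm (apply_C1 z 0) + c * T) * exp (L * T)"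
proof -
  have gron: "norm (apply_C1 z s) \<le> (norm (apply_C1 z 0) + c * T) * exp (L * T)"
    if s: "s \<in> {0..T}" and below: "\<And>r. r \<in> {0..s} \<Longrightarrow> norm (apply_C1 z r) \<le> d" for s
  proof -
    have "norm (apply_C1 z s) \<le> (norm (apply_C1 z 0) + c * s) * exp (L * s)"
    proof (rule gronwall_vector_derivative[where z' = "deriv_C1 z"])
      show "(apply_C1 z has_vector_derivative deriv_C1 z r) (at r within {0..s})"
        if "r \<in> {0..s}" for r
        using that by (intro has_vector_derivative_within_subset[OF C1_has_vector_derivative]) auto
    qed (use s L c bound below in auto)
    also have "\<dots> \<le> (norm (apply_C1 z 0) + c * T) * exp (L * T)"
      using s L c by (intro mult_mono add_mono mult_left_mono) (auto intro: mult_left_mono)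
    finally show ?thesis .
  qed
  have cont: "continuous_on {0..s} (\<lambda>r. norm (apply_C1 z r))" for s
    by (intro continuous_on_norm continuous_on_subset[OF continuous_on_apply_C1]) auto
  have below: "norm (apply_C1 z r) \<le> d" if r: "r \<in> {0..T}" for r
  proof (rule ccontr)
    assume not: "\<not> norm (apply_C1 z r) \<le> d"
    define K where "K = {s \<in> {0..r}. norm (apply_C1 z s) \<in> {d..}}"
    have "norm (apply_C1 z 0) \<le> (norm (apply_C1 z 0) + c * T) * exp (L * T)"
      using L c r mult_mono[of "norm (apply_C1 z 0)" "norm (apply_C1 z 0) + c * T" 1 "exp (L * T)"]
      by auto
    then have z0: "norm (apply_C1 z 0) < d" using small by simp
    have "K = {0..r} \<inter> (\<lambda>s. norm (apply_C1 z s)) -` {d..}" by (auto simp: K_def)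
    then have "closed K" using continuous_closed_preimage[OF cont[of r], of "{d..}"] by simp
    moreover have "K \<noteq> {}" using not r by (auto simp: K_def)
    moreover have bdd: "bdd_below K" by (auto simp: K_def intro!: bdd_belowI[of _ 0])
    ultimately have K: "Inf K \<in> K" by (intro closed_contains_Inf)
    define s where "s = Inf K"
    have s: "s \<in> {0..r}" "d \<le> norm (apply_C1 z s)" using K by (auto simp: K_def s_def)
    have before: "norm (apply_C1 z q) < d" if "q \<in> {0..<s}" for q
      using that s cInf_lower[OF _ bdd, of q] by (force simp: K_def s_def)
    have "norm (apply_C1 z s) \<le> d"
    proof -
      obtain q where q: "0 \<le> q" "q \<le> s" "norm (apply_C1 z q) = d"
        using IVT'[of "\<lambda>r. norm (apply_C1 z r)" 0 d s] z0 s cont by auto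
      then have "q = s" using before[of q] by force
      then show ?thesis using q by simp
    qed
    then have "norm (apply_C1 z q) \<le> d" if "q \<in> {0..s}" for q
      using before[of q] that by (cases "q = s") auto
    then have "norm (apply_C1 z s) < d" using gron[of s] s r small by auto
    then show False using s by simp
  qed
  show ?thesis using t below by (intro gron) auto
qed

lemma gronwall_C1:
  fixes z :: "'a::banach C1"
  assumes L: "0 \<le> L" and c: "0 \<le> c"
    and bound: "\<And>t. t \<in> {0..T} \<Longrightarrow> norm (deriv_C1 z t) \<le> L * norm (apply_C1 z t) + c"
    and t: "t \<in> {0..T}"
  shows "norm (apply_C1 z t) \<le> (norm (apply_C1 z 0) + c * T) * exp (L * T)"
  using assms
  by (intro gronwall_C1_bootstrap[where d = "(norm (apply_C1 z 0) + c * T) * exp (L * T) + 1"]) auto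

text \<open>
  The difference \<open>z\<close> of the two paths has derivative \<open>(G(X) - g(X)) + (g(X) - g(x))\<close>: the first term is
  uniformly small on the bounded tube around the trajectory, the second is Lipschitz in \<open>z\<close> there.
  The filter is arbitrary so that the result serves sequences as well as continuity of the flow.
\<close>

lemma flow_stable:
  fixes g :: "('e::banach, 'e) C0b"
  assumes lip: "\<And>p. \<exists>u>0. \<exists>L. L-lipschitz_on (cball p u) (apply_C0b g)"
    and x: "solves (apply_C0b g) x0 x"
    and X: "\<forall>\<^sub>F i in net. solves (apply_C0b (G i)) (\<xi> i) (X i)"
    and \<xi>: "(\<xi> \<longlongrightarrow> x0) net" and G: "(G \<longlongrightarrow> g) net"
  shows "(X \<longlongrightarrow> x) net"
proof (rule tendsto_C1I)
  fix T e :: real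
  assume T: "T > 0" and e: "e > 0"
  obtain d L where d: "d > 0" and L: "L \<ge> 0" and
    gL: "\<And>p q. p \<in> apply_C1 x ` {0..T} \<Longrightarrow> dist q p < d \<Longrightarrow>
      dist (apply_C0b g q) (apply_C0b g p) \<le> L * dist q p"
    using lipschitz_near_compact[OF lip compact_path] by metis
  define B where "B = {q. \<exists>p\<in>apply_C1 x ` {0..T}. dist q p \<le> d}"
  have "bounded B"
    unfolding B_def by (rule bounded_tube[OF compact_imp_bounded[OF compact_path]])
  define K where "K = (1 + T) * exp (L * T)"
  have K: "K \<ge> 1" using T L mult_mono[of 1 "1 + T" 1 "exp (L * T)"] by (simp add: K_def)
  \<comment> \<open>The size of the data perturbation: it keeps the paths in the tube of radius \<open>d\<close> and both they
    and their derivatives within \<open>e\<close>.\<close>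
  define c where "c = min d e / 2 / ((L + 1) * K)"
  have c: "c > 0" using d e L K by (simp add: c_def)
  have LK: "(L + 1) * (K * c) = min d e / 2"
  proof -
    have "(L + 1) * K \<noteq> 0" using L K by auto
    then have "((L + 1) * K) * c = min d e / 2"
      unfolding c_def by (metis nonzero_mult_div_cancel_left times_divide_eq_right)
    then show ?thesis by (simp only: mult.assoc)
  qed
  have Kc: "K * c \<le> (L + 1) * (K * c)" using K c L by (simp add: ring_distribs)
  have cK: "c \<le> K * c" using K c by simp
  have "\<forall>\<^sub>F i in net. norm (\<xi> i - x0) < c"
    using tendstoD[OF \<xi> c] by (simp add: dist_norm)
  moreover have "\<forall>\<^sub>F i in net. \<forall>q\<in>B. dist (apply_C0b (G i) q) (apply_C0b g q) < c"
    using G \<open>bounded B\<close> c uniform_limitD unfolding tendsto_C0b_iff by blast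
  ultimately show "\<forall>\<^sub>F i in net. \<forall>t\<in>{0..T}. norm (apply_C1 (X i) t - apply_C1 x t) < e \<and>
      norm (deriv_C1 (X i) t - deriv_C1 x t) < e"
    using X
  proof eventually_elim
    case (elim i)
    define z where "z = X i - x"
    have dz: "norm (deriv_C1 z t) \<le> L * norm (apply_C1 z t) + c"
      if t: "t \<in> {0..T}" and le: "norm (apply_C1 z t) \<le> 3 * d / 4" for t
    proof -
      let ?p = "apply_C1 x t" and ?q = "apply_C1 (X i) t"
      have near: "dist ?q ?p < d" using le d by (simp add: z_def dist_norm)
      have "?p \<in> apply_C1 x ` {0..T}" using t by auto
      then have "?q \<in> B" using near unfolding B_def by (blast intro: less_imp_le)
      then have "norm (apply_C0b (G i) ?q - apply_C0b g ?q) \<le> c"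
        using elim(2) by (force simp: dist_norm)
      moreover have "norm (apply_C0b g ?q - apply_C0b g ?p) \<le> L * norm (?q - ?p)"
        using gL[of ?p ?q] t near by (auto simp: dist_norm)
      moreover have "deriv_C1 z t = (apply_C0b (G i) ?q - apply_C0b g ?q) +
          (apply_C0b g ?q - apply_C0b g ?p)"
        using t elim(3) x by (simp add: z_def deriv_C1_diff solves_def)
      ultimately show ?thesis
        using norm_triangle_ineq[of "apply_C0b (G i) ?q - apply_C0b g ?q"
          "apply_C0b g ?q - apply_C0b g ?p"] by (simp add: z_def)
    qed
    have z0: "(norm (apply_C1 z 0) + c * T) * exp (L * T) \<le> K * c"
    proof -
      have "norm (apply_C1 z 0) + c * T \<le> (1 + T) * c"
        using elim(1,3) x by (simp add: z_def solves_def algebra_simps)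
      from mult_right_mono[OF this, of "exp (L * T)"] show ?thesis by (simp add: K_def mult_ac)
    qed
    have z: "norm (apply_C1 z t) \<le> K * c" if t: "t \<in> {0..T}" for t
    proof -
      have small: "(norm (apply_C1 z 0) + c * T) * exp (L * T) < 3 * d / 4"
        using z0 Kc LK d by (auto simp: min_def split: if_splits)
      have "norm (apply_C1 z t) \<le> (norm (apply_C1 z 0) + c * T) * exp (L * T)"
        using L c t dz small by (intro gronwall_C1_bootstrap[where d = "3 * d / 4"]) auto
      then show ?thesis using z0 by simp
    qed
    show ?case
    proof (intro ballI conjI)
      fix t assume t: "t \<in> {0..T}"
      have "K * c < e" using Kc LK d e by (auto simp: min_def split: if_splits)
      then show "norm (apply_C1 (X i) t - apply_C1 x t) < e"
        using z[OF t] by (simp add: z_def)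
      have "K * c \<le> 3 * d / 4" using d Kc LK by (auto simp: min_def split: if_splits)
      then have "norm (deriv_C1 z t) \<le> L * norm (apply_C1 z t) + c"
        using z[OF t] by (intro dz[OF t]) simp
      also have "\<dots> \<le> L * (K * c) + K * c"
        using z[OF t] L cK by (intro add_mono mult_left_mono) auto
      also have "\<dots> < e" using LK e d by (simp add: algebra_simps min_def split: if_splits)
      finally show "norm (deriv_C1 (X i) t - deriv_C1 x t) < e"
        using t by (simp add: z_def deriv_C1_diff)
    qed
  qed
qed

definition flow where
  "flow z = (THE X. solves (apply_C0b (snd z)) (fst z) X)"

lemma solves_flow:
  assumes "complete_field (apply_C0b (snd z))"
  shows "solves (apply_C0b (snd z)) (fst z) (flow z)"
    "solves (apply_C0b (snd z)) (fst z) X \<Longrightarrow> X = flow z"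
proof -
  have ex1: "\<exists>!X. solves (apply_C0b (snd z)) (fst z) X" using assms by (simp add: complete_field_def)
  show "solves (apply_C0b (snd z)) (fst z) (flow z)"
    unfolding flow_def by (rule theI'[OF ex1])
  then show "solves (apply_C0b (snd z)) (fst z) X \<Longrightarrow> X = flow z" using ex1 by blast
qed

text \<open>
  Continuity relative to the complete fields is what makes the random solution measurable as a
  function of its random data.
\<close>

lemma continuous_on_flow:
  "continuous_on {z :: 'e::banach \<times> ('e, 'e) C0b. complete_field (apply_C0b (snd z))} flow"
  unfolding continuous_on_def
proof
  let ?D = "{z :: 'e \<times> ('e, 'e) C0b. complete_field (apply_C0b (snd z))}"
  fix z assume z: "z \<in> ?D"
  show "(flow \<longlongrightarrow> flow z) (at z within ?D)"
  proof (rule flow_stable)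
    show "\<exists>u>0. \<exists>L. L-lipschitz_on (cball p u) (apply_C0b (snd z))" for p
      using z by (simp add: complete_field_def)
    show "solves (apply_C0b (snd z)) (fst z) (flow z)" using z by (simp add: solves_flow)
    show "\<forall>\<^sub>F w in at z within ?D. solves (apply_C0b (snd w)) (fst w) (flow w)"
      unfolding eventually_at_filter by (simp add: solves_flow)
    show "(fst \<longlongrightarrow> fst z) (at z within ?D)" "(snd \<longlongrightarrow> snd z) (at z within ?D)"
      by (rule tendsto_fst[OF tendsto_ident_at], rule tendsto_snd[OF tendsto_ident_at])
  qed
qed

section \<open>The derivative as an operator on the larger space\<close>

text \<open>
  The bound makes \<open>h\<close> factor through \<open>j\<close> as a Lipschitz map on the range of \<open>j\<close>; it extends to the
  closure, and linearity passes to the closure because it is an identity between continuous maps.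
\<close>

lemma bounded_linear_extension_dense:
  fixes j :: "'e::real_normed_vector \<Rightarrow> 'f::real_normed_vector" and h :: "'e \<Rightarrow> 'g::banach"
  assumes j: "linear j" and dense: "closure (range j) = UNIV" and h: "linear h"
    and bound: "\<And>v. norm (h v) \<le> C * norm (j v)"
  shows "\<exists>A :: 'f \<Rightarrow>\<^sub>L 'g. \<forall>v. blinfun_apply A (j v) = h v"
proof -
  have hj: "h v = h w" if "j v = j w" for v w
    using bound[of "v - w"] that by (simp add: linear_diff[OF j] linear_diff[OF h])
  define k0 where "k0 w = h (SOME v. j v = w)" for w
  have k0: "k0 (j v) = h v" for v
    unfolding k0_def by (rule hj, rule someI) simp
  have "(max C 0)-lipschitz_on (range j) k0"
  proof (rule lipschitz_onI)
    fix p q assume "p \<in> range j" "q \<in> range j"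
    then obtain v w where vw: "p = j v" "q = j w" by auto
    have "norm (h (v - w)) \<le> max C 0 * norm (j (v - w))"
      using bound[of "v - w"] mult_right_mono[of C "max C 0" "norm (j (v - w))"] by simp
    then show "dist (k0 p) (k0 q) \<le> max C 0 * dist p q"
      by (simp add: vw k0 dist_norm linear_diff[OF h] linear_diff[OF j])
  qed simp
  from lipschitz_extend_closure[OF this] obtain k
    where lip: "(max C 0)-lipschitz_on UNIV k" and k: "\<forall>w\<in>range j. k w = k0 w"
    unfolding dense by (elim exE conjE)
  have kj: "k (j v) = h v" for v using k by (simp add: k0)
  have cont: "continuous_on UNIV k" by (rule lipschitz_on_continuous_on[OF lip])
  then have ck: "continuous_on UNIV (\<lambda>p. k (f p))" if "continuous_on UNIV f" for f :: "'f \<Rightarrow> 'f"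
    by (rule continuous_on_compose2[OF _ that]) simp
  have dense_induct: "P p" if "closed {p. P p}" "\<And>v. P (j v)" for P and p :: 'f
  proof -
    have "closure (range j) \<subseteq> {p. P p}" using that by (intro closure_minimal) auto
    then show ?thesis unfolding dense by blast
  qed
  have add: "k (p + q) = k p + k q" for p q
  proof (rule dense_induct[of "\<lambda>p. k (p + q) = k p + k q" for q])
    show "closed {p. k (p + q) = k p + k q}"
      by (intro closed_Collect_eq ck continuous_intros)
    show "k (j v + q) = k (j v) + k q" for v
    proof (rule dense_induct[of "\<lambda>q. k (j v + q) = k (j v) + k q"])
      show "closed {q. k (j v + q) = k (j v) + k q}"
        by (intro closed_Collect_eq ck continuous_intros)
      show "k (j v + j w) = k (j v) + k (j w)" for w
        by (simp add: kj linear_add[OF h] flip: linear_add[OF j])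
    qed
  qed
  have scale: "k (c *\<^sub>R p) = c *\<^sub>R k p" for c p
  proof (rule dense_induct[of "\<lambda>p. k (c *\<^sub>R p) = c *\<^sub>R k p"])
    show "closed {p. k (c *\<^sub>R p) = c *\<^sub>R k p}"
      by (intro closed_Collect_eq ck continuous_intros)
    show "k (c *\<^sub>R j v) = c *\<^sub>R k (j v)" for v
      by (simp add: kj linear_scale[OF h] flip: linear_scale[OF j])
  qed
  have "bounded_linear k"
  proof (rule bounded_linear_intro[OF add scale])
    show "norm (k p) \<le> norm p * max C 0" for p
      using lipschitz_onD[OF lip, of p 0] scale[of 0 0] by (simp add: dist_norm mult.commute)
  qed
  then show ?thesis
    by (intro exI[of _ "Blinfun k"]) (simp add: bounded_linear_Blinfun_apply kj)
qed

lemma norm_blinfun_le_dense: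
  assumes "closure (range j) = UNIV" "0 \<le> C"
    and "\<And>v. norm (blinfun_apply A (j v)) \<le> C * norm (j v)"
  shows "norm A \<le> C"
proof (rule norm_blinfun_bound[OF assms(2)])
  have "closed {w. norm (blinfun_apply A w) \<le> C * norm w}"
    by (intro closed_Collect_le continuous_intros)
  then have "closure (range j) \<subseteq> {w. norm (blinfun_apply A w) \<le> C * norm w}"
    using assms(3) by (intro closure_minimal) auto
  then show "norm (blinfun_apply A w) \<le> C * norm w" for w using assms(1) by auto
qed

text \<open>
  Continuity at the origin bounds \<open>B\<close> on a small ball of the larger norm; the rest is homogeneity,
  where injectivity of \<open>\<iota>\<close> ensures that every nonzero vector can be rescaled.
\<close>

lemma continuous_map_via_bounded:
  fixes \<iota> :: "'e::real_normed_vector \<Rightarrow> 'f::real_normed_vector"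
  assumes \<iota>: "linear \<iota>" "inj \<iota>" and B: "linear B"
    and cont: "continuous_map (topology_via \<iota>) (topology_via \<iota>) B"
  shows "\<exists>C\<ge>0. \<forall>v. norm (\<iota> (B v)) \<le> C * norm (\<iota> v)"
proof -
  have "openin (topology_via \<iota>) (\<iota> -` ball 0 1)"
    unfolding topology_via_def openin_pullback_topology by (intro exI[of _ "ball 0 1"]) auto
  moreover have "topspace (topology_via \<iota>) = UNIV"
    by (simp add: topology_via_def topspace_pullback_topology)
  ultimately have "openin (topology_via \<iota>) {v. B v \<in> \<iota> -` ball 0 1}"
    using openin_continuous_map_preimage[OF cont, of "\<iota> -` ball 0 1"] by simp
  then obtain U where U: "open U" "{v. B v \<in> \<iota> -` ball 0 1} = \<iota> -` U"
    unfolding topology_via_def openin_pullback_topology by auto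
  have "0 \<in> \<iota> -` U" unfolding U(2)[symmetric] by (simp add: linear_0 \<iota> B)
  then obtain r where r: "r > 0" "ball 0 r \<subseteq> U"
    using U(1) by (auto simp: linear_0 \<iota> open_contains_ball)
  have small: "norm (\<iota> (B v)) < 1" if "norm (\<iota> v) < r" for v
    using U(2) r(2) that by (auto simp: set_eq_iff subset_iff)
  have "norm (\<iota> (B v)) \<le> 2 / r * norm (\<iota> v)" for v
  proof (cases "v = 0")
    case True
    then show ?thesis by (simp add: linear_0 \<iota> B)
  next
    case False
    then have nz: "norm (\<iota> v) > 0" using \<iota> by (metis linear_0 injD zero_less_norm_iff)
    define s where "s = r / 2 / norm (\<iota> v)"
    have s: "s > 0" using r nz by (simp add: s_def)
    have "norm (\<iota> (s *\<^sub>R v)) < r" using r nz s by (simp add: linear_scale \<iota> s_def)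
    from small[OF this] have "s * norm (\<iota> (B v)) < 1"
      using s by (simp add: linear_scale \<iota> B)
    then show ?thesis using r nz by (simp add: s_def field_simps)
  qed
  then show ?thesis using r(1) by (intro exI[of _ "2 / r"]) auto
qed

text \<open>
  A real supremum is meaningful only if it is bounded, whence the a priori constant \<open>C\<close>.
\<close>

lemma onorm_via_bound:
  assumes "linear \<iota>" "\<And>v. norm (\<iota> (B v)) \<le> C * norm (\<iota> v)" "C \<ge> 0"
  shows "norm (\<iota> (B v)) \<le> onorm_via \<iota> B * norm (\<iota> v)" "onorm_via \<iota> B \<ge> 0"
proof -
  have "norm (\<iota> (B w)) / norm (\<iota> w) \<le> C" for w
    using assms(2)[of w] assms(3) by (cases "norm (\<iota> w) = 0") (auto simp: field_simps)
  then have "bdd_above (range (\<lambda>v. norm (\<iota> (B v)) / norm (\<iota> v)))" by (auto intro!: bdd_aboveI)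
  then have upper: "norm (\<iota> (B w)) / norm (\<iota> w) \<le> onorm_via \<iota> B" for w
    unfolding onorm_via_def by (intro cSUP_upper) auto
  show "norm (\<iota> (B v)) \<le> onorm_via \<iota> B * norm (\<iota> v)"
    using upper[of v] assms(2)[of v] by (cases "norm (\<iota> v) = 0") (auto simp: field_simps)
  show "onorm_via \<iota> B \<ge> 0" using upper[of 0] by (rule order_trans[rotated]) simp
qed

text \<open>
  Bundling the extended derivatives as elements of a normed space turns continuity in \<^const>\<open>onorm_via\<close>
  into plain continuity: by density, an operator bound on the smaller space is one on the larger.
\<close>

lemma C1_via_derivative_extension:
  fixes \<iota> :: "'e::real_normed_vector \<Rightarrow> 'f::banach"
  assumes emb: "dense_embedding \<iota>" and f: "C1_via \<iota> f"
  obtains A :: "'e \<Rightarrow> 'f \<Rightarrow>\<^sub>L 'f" where "continuous_on UNIV A"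
    "\<forall>p v. blinfun_apply (A p) (\<iota> v) = \<iota> (frechet_derivative f (at p) v)"
    "\<forall>p. extension_via \<iota> (frechet_derivative f (at p)) = blinfun_apply (A p)"
proof -
  let ?D = "\<lambda>p. frechet_derivative f (at p)"
  have \<iota>: "linear \<iota>" "inj \<iota>" and dense: "closure (range \<iota>) = UNIV"
    using emb by (auto simp: dense_embedding_def)
  have D: "linear (?D p)" for p using f by (auto simp: C1_via_def)
  have D_bound: "\<exists>C\<ge>0. \<forall>v. norm (\<iota> (?D p v)) \<le> C * norm (\<iota> v)" for p
    using f by (intro continuous_map_via_bounded \<iota> D) (simp add: C1_via_def)
  have "\<exists>A. \<forall>v. blinfun_apply A (\<iota> v) = \<iota> (?D p v)" for p
  proof -
    obtain C where "\<And>v. norm (\<iota> (?D p v)) \<le> C * norm (\<iota> v)" using D_bound by meson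
    then show ?thesis
      by (rule bounded_linear_extension_dense[OF \<iota>(1) dense linear_compose[OF D \<iota>(1), unfolded o_def]])
  qed
  then have "\<forall>p. \<exists>A. \<forall>v. blinfun_apply A (\<iota> v) = \<iota> (?D p v)" by blast
  from choice[OF this] obtain A where A: "\<And>p v. blinfun_apply (A p) (\<iota> v) = \<iota> (?D p v)" by blast
  have "isCont A p" for p
  proof -
    define N where "N q = onorm_via \<iota> (\<lambda>v. ?D q v - ?D p v)" for q
    have le: "norm (A q - A p) \<le> N q" for q
    proof -
      obtain C C' where C: "C \<ge> 0" "\<And>v. norm (\<iota> (?D q v)) \<le> C * norm (\<iota> v)"
        and C': "C' \<ge> 0" "\<And>v. norm (\<iota> (?D p v)) \<le> C' * norm (\<iota> v)"
        using D_bound by meson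
      have "norm (\<iota> (?D q v - ?D p v)) \<le> (C + C') * norm (\<iota> v)" for v
        using norm_triangle_ineq4[of "\<iota> (?D q v)" "\<iota> (?D p v)"] C(2)[of v] C'(2)[of v]
        by (simp add: linear_diff \<iota> algebra_simps)
      note diff_bound = this
      define B where "B v = ?D q v - ?D p v" for v
      have le: "norm (\<iota> (B v)) \<le> (C + C') * norm (\<iota> v)" for v
        unfolding B_def by (rule diff_bound)
      have C0: "0 \<le> C + C'" using C(1) C'(1) by simp
      have bd: "norm (\<iota> (B v)) \<le> onorm_via \<iota> B * norm (\<iota> v)" "0 \<le> onorm_via \<iota> B" for v
        using onorm_via_bound[OF \<iota>(1) le C0] by blast+
      have "norm (A q - A p) \<le> onorm_via \<iota> B"
        by (rule norm_blinfun_le_dense[OF dense bd(2)])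
          (use bd(1) in \<open>simp add: B_def blinfun.diff_left A linear_diff \<iota>\<close>)
      then show ?thesis unfolding B_def N_def .
    qed
    have N: "(N \<longlongrightarrow> 0) (at p)"
      using f unfolding C1_via_def N_def by (elim conjE) (erule spec)
    have "((\<lambda>q. A q - A p) \<longlongrightarrow> 0) (at p)"
      by (rule Lim_null_comparison[OF _ N]) (simp add: le)
    then show ?thesis by (simp add: isCont_def LIM_zero_iff)
  qed
  moreover have "extension_via \<iota> (?D p) = blinfun_apply (A p)" for p
    unfolding extension_via_def
  proof (rule the_equality)
    show "bounded_linear (blinfun_apply (A p)) \<and> (\<forall>v. blinfun_apply (A p) (\<iota> v) = \<iota> (?D p v))"
      using A by (simp add: blinfun.bounded_linear_right)
    fix A' assume A': "bounded_linear A' \<and> (\<forall>v. A' (\<iota> v) = \<iota> (?D p v))"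
    have "closed {w. A' w = blinfun_apply (A p) w}"
      using A' by (intro closed_Collect_eq linear_continuous_on blinfun.bounded_linear_right) auto
    then have "closure (range \<iota>) \<subseteq> {w. A' w = blinfun_apply (A p) w}"
      using A A' by (intro closure_minimal) auto
    then show "A' = blinfun_apply (A p)" using dense by auto
  qed
  ultimately show thesis
    using A by (intro that[of A]) (simp_all add: continuous_at_imp_continuous_on)
qed

text \<open>
  The mean value inequality in the larger norm: along the segment from \<open>p\<close> to \<open>p + h\<close> the image
  path has derivative \<open>A(p + s h) (\<iota> h)\<close>, which involves \<open>h\<close> only through \<open>\<iota> h\<close>. This is why the error
  is controlled by the weaker norm of \<open>h\<close>, as required for fluctuations that are bounded only there.
\<close>

lemma scaled_increment_bound:
  fixes \<iota> :: "'e::real_normed_vector \<Rightarrow> 'f::banach"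
  assumes \<iota>: "bounded_linear \<iota>" and g: "\<And>p. g differentiable (at p)"
    and A: "\<forall>p v. blinfun_apply (A p) (\<iota> v) = \<iota> (frechet_derivative g (at p) v)"
    and near: "\<And>s. s \<in> {0..1} \<Longrightarrow> norm (A (p + s *\<^sub>R h) - A p) \<le> e"
  shows "norm (\<iota> (g (p + h)) - \<iota> (g p) - blinfun_apply (A p) (\<iota> h)) \<le> e * norm (\<iota> h)"
proof -
  interpret bounded_linear \<iota> by (rule \<iota>)
  have d: "((\<lambda>s. \<iota> (g (p + s *\<^sub>R h))) has_vector_derivative blinfun_apply (A (p + s *\<^sub>R h)) (\<iota> h))
      (at s within {0..1})" for s
  proof -
    let ?D = "frechet_derivative g (at (p + s *\<^sub>R h))"
    have gD: "(g has_derivative ?D) (at (p + s *\<^sub>R h))"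
      using g frechet_derivative_works by blast
    have "((\<lambda>s. p + s *\<^sub>R h) has_derivative (\<lambda>s. s *\<^sub>R h)) (at s within {0..1})"
      by (auto intro!: derivative_eq_intros)
    from has_derivative_compose[OF this gD]
    have "((\<lambda>s. g (p + s *\<^sub>R h)) has_vector_derivative ?D h) (at s within {0..1})"
      unfolding has_vector_derivative_def
      using linear_scale[OF has_derivative_linear[OF gD]] by simp
    from bounded_linear.has_vector_derivative[OF \<iota> this] show ?thesis by (simp add: A)
  qed
  have "norm (\<iota> (g (p + 1 *\<^sub>R h)) - \<iota> (g (p + 0 *\<^sub>R h)) -
      (1 - 0) *\<^sub>R blinfun_apply (A (p + 0 *\<^sub>R h)) (\<iota> h)) \<le> norm (1 - 0 :: real) * (e * norm (\<iota> h))"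
  proof (rule vector_differentiable_bound_linearization[where S = "{0..1}"])
    show "norm (blinfun_apply (A (p + s *\<^sub>R h)) (\<iota> h) - blinfun_apply (A (p + 0 *\<^sub>R h)) (\<iota> h))
        \<le> e * norm (\<iota> h)" if "s \<in> {0..1}" for s
    proof -
      have "norm (blinfun_apply (A (p + s *\<^sub>R h) - A p) (\<iota> h)) \<le> e * norm (\<iota> h)"
        by (rule order_trans[OF norm_blinfun mult_right_mono[OF near[OF that]]]) simp
      then show ?thesis by (simp add: blinfun.diff_left)
    qed
  qed (use d in \<open>auto simp: closed_segment_eq_real_ivl\<close>)
  then show ?thesis by simp
qed

section \<open>Linear equations with continuous coefficients\<close>

lemma integral_Ici_has_vector_derivative:
  fixes h :: "real \<Rightarrow> 'a::banach"
  assumes "continuous_on {0..} h" "t \<ge> 0"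
  shows "((\<lambda>t. integral {0..t} h) has_vector_derivative h t) (at t within {0..})"
proof -
  have "((\<lambda>t. integral {0..t} h) has_vector_derivative h t) (at t within {0..t + 1})"
    using assms by (intro integral_has_vector_derivative continuous_on_subset[OF assms(1)]) auto
  also have "at t within {0..t + 1} = at t within {0..}"
    by (rule at_within_nhd[of t "{..<t + 1}"]) (use assms(2) in auto)
  finally show ?thesis .
qed

lemma continuous_on_integral_Ici:
  fixes h :: "real \<Rightarrow> 'a::banach"
  assumes "continuous_on {0..} h"
  shows "continuous_on {0..} (\<lambda>t. integral {0..t} h)"
  unfolding continuous_on_eq_continuous_within
proof
  fix t :: real assume "t \<in> {0..}"
  then show "continuous (at t within {0..}) (\<lambda>t. integral {0..t} h)"
    using has_vector_derivative_continuous[OF integral_Ici_has_vector_derivative[OF assms, of t]] by simp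
qed

lemma continuous_on_clamp:
  assumes "continuous_on {0::real..} h"
  shows "continuous_on UNIV (\<lambda>t. h (max 0 t))"
  by (rule continuous_on_compose2[OF assms]) (auto intro!: continuous_intros)

text \<open>
  A single contraction on the whole half-line: with the weight \<open>W(t) = exp (2 \<integral>\<^sub>0\<^sup>t (|A| + |b|))\<close> the
  substitution \<open>y = W u\<close> turns the integral equation into one for a bounded continuous \<open>u\<close>, and
  \<open>\<integral>\<^sub>0\<^sup>t (|A| + |b|) W \<le> W(t) / 2\<close> makes the right-hand side a contraction with constant 1/2. The functions
  are continued to negative times by their value at zero.
\<close>

lemma linear_ode_exists:
  fixes A :: "real \<Rightarrow> 'f::banach \<Rightarrow>\<^sub>L 'f" and b :: "real \<Rightarrow> 'f"
  assumes A: "continuous_on {0..} A" and b: "continuous_on {0..} b"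
  obtains y where "apply_C1 y 0 = y0"
    "\<And>t. t \<ge> 0 \<Longrightarrow> deriv_C1 y t = blinfun_apply (A t) (apply_C1 y t) + b t"
proof -
  define a where "a t = norm (A t) + norm (b t)" for t
  have ca: "continuous_on {0..} a" unfolding a_def by (intro continuous_intros A b)
  have a: "a t \<ge> 0" for t by (simp add: a_def)
  define W where "W t = exp (2 * integral {0..t} a)" for t
  have cW: "continuous_on {0..} W"
    unfolding W_def by (intro continuous_intros continuous_on_integral_Ici ca)
  have W1: "W t \<ge> 1" if "t \<ge> 0" for t
    unfolding W_def
    using integral_nonneg[OF integrable_continuous_real[OF continuous_on_subset[OF ca]], of 0 t] a that
    by auto
  have int_aW: "integral {0..t} (\<lambda>s. a s * W s) \<le> W t / 2" if t: "t \<ge> 0" for t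
  proof -
    have dW: "((\<lambda>s. W s / 2) has_vector_derivative a s * W s) (at s within {0..t})"
      if "s \<in> {0..t}" for s
    proof -
      have "((\<lambda>t. integral {0..t} a) has_real_derivative a s) (at s within {0..})"
        using integral_Ici_has_vector_derivative[OF ca, of s] that
        by (simp add: has_real_derivative_iff_has_vector_derivative)
      from DERIV_subset[OF this, of "{0..t}"]
      show ?thesis
        unfolding W_def has_real_derivative_iff_has_vector_derivative[symmetric]
        by (auto intro!: derivative_eq_intros)
    qed
    have "((\<lambda>s. a s * W s) has_integral (W t / 2 - W 0 / 2)) {0..t}"
      using t dW by (rule fundamental_theorem_of_calculus)
    then show ?thesis using W1[of 0] by (simp add: integral_unique)
  qed
  have caW: "continuous_on {0..} (\<lambda>s. a s * W s)" by (intro continuous_intros ca cW)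
  \<comment> \<open>A forcing dominated by \<open>c * a * W\<close> has, after division by \<open>W\<close>, a primitive of size \<open>c / 2\<close>.\<close>
  have prim: "norm (inverse (W t) *\<^sub>R integral {0..t} h) \<le> c / 2"
    if t: "t \<ge> 0" and h: "continuous_on {0..} h" and c: "c \<ge> 0"
      and le: "\<And>s. s \<in> {0..t} \<Longrightarrow> norm (h s) \<le> c * (a s * W s)" for t c and h :: "real \<Rightarrow> 'f"
  proof -
    have "norm (integral {0..t} h) \<le> integral {0..t} (\<lambda>s. c * (a s * W s))"
      by (rule Henstock_Kurzweil_Integration.integral_norm_bound_integral)
        (use le in \<open>auto intro!: integrable_continuous_real continuous_on_subset[OF h]
          continuous_on_mult continuous_on_const continuous_on_subset[OF ca] continuous_on_subset[OF cW]\<close>)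
    also have "\<dots> \<le> c * (W t / 2)" using mult_left_mono[OF int_aW[OF t] c] by simp
    finally show ?thesis using W1[OF t] by (simp add: field_simps)
  qed
  define F where "F u s = blinfun_apply (A s) (W s *\<^sub>R apply_bcontfun u s) + b s"
    for u :: "real \<Rightarrow>\<^sub>C 'f" and s
  have cF: "continuous_on {0..} (F u)" for u
    unfolding F_def by (intro continuous_intros A b cW) simp
  define R where "R u t = inverse (W (max 0 t)) *\<^sub>R (y0 + integral {0..max 0 t} (F u))"
    for u t
  have R: "R u \<in> bcontfun" for u
  proof (rule bcontfun_normI)
    have "continuous_on {0..} (\<lambda>t. inverse (W t) *\<^sub>R (y0 + integral {0..t} (F u)))"
      using W1 by (intro continuous_intros cW continuous_on_integral_Ici cF) force
    from continuous_on_clamp[OF this] show "continuous_on UNIV (R u)" unfolding R_def .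
    show "norm (R u t) \<le> norm y0 + (norm u + 1) / 2" for t
    proof -
      let ?t = "max 0 t"
      have "norm (inverse (W ?t) *\<^sub>R integral {0..?t} (F u)) \<le> (norm u + 1) / 2"
      proof (rule prim[OF _ cF])
        fix s assume s: "s \<in> {0..?t}"
        have "norm (blinfun_apply (A s) (W s *\<^sub>R apply_bcontfun u s)) \<le> norm (A s) * (W s * norm u)"
          using norm_blinfun[of "A s" "W s *\<^sub>R apply_bcontfun u s"] norm_bounded[of u s] W1[of s] s
          by (auto intro!: order_trans[OF norm_blinfun] mult_left_mono)
        moreover have "norm (b s) \<le> norm (b s) * W s"
          using W1[of s] s by (simp add: mult_le_cancel_left1)
        moreover have "0 \<le> norm (A s) * W s" "0 \<le> norm (b s) * W s * norm u"
          using W1[of s] s by auto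
        ultimately show "norm (F u s) \<le> (norm u + 1) * (a s * W s)"
          unfolding F_def a_def
          using norm_triangle_ineq[of "blinfun_apply (A s) (W s *\<^sub>R apply_bcontfun u s)" "b s"]
          by (simp add: algebra_simps)
      qed auto
      moreover have "norm (inverse (W ?t) *\<^sub>R y0) \<le> norm y0"
        using W1[of ?t] mult_left_mono[of 1 "W ?t" "norm y0"] by (simp add: field_simps)
      ultimately show ?thesis
        unfolding R_def scaleR_add_right by (meson add_mono norm_triangle_le)
    qed
  qed
  have "\<exists>!u. Bcontfun (R u) = u"
  proof (rule banach_fix_type)
    show "\<forall>u v. dist (Bcontfun (R u)) (Bcontfun (R v)) \<le> 1 / 2 * dist u v"
    proof (intro allI dist_bound)
      fix u v :: "real \<Rightarrow>\<^sub>C 'f" and t :: real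
      let ?t = "max 0 t"
      have int: "F w integrable_on {0..?t}" for w
        by (intro integrable_continuous_real continuous_on_subset[OF cF]) auto
      have "norm (inverse (W ?t) *\<^sub>R integral {0..?t} (\<lambda>s. F u s - F v s)) \<le> dist u v / 2"
      proof (rule prim)
        fix s assume s: "s \<in> {0..?t}"
        have "norm (F u s - F v s) = norm (blinfun_apply (A s) (W s *\<^sub>R (apply_bcontfun u s - apply_bcontfun v s)))"
          by (simp add: F_def blinfun.diff_right scaleR_diff_right)
        also have "\<dots> \<le> norm (A s) * (W s * dist u v)"
          using dist_bounded[of u s v] W1[of s] s
          by (auto intro!: order_trans[OF norm_blinfun] mult_left_mono simp: dist_norm)
        also have "\<dots> \<le> a s * (W s * dist u v)"
          using W1[of s] s by (intro mult_right_mono) (auto simp: a_def)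
        finally show "norm (F u s - F v s) \<le> dist u v * (a s * W s)" by (simp add: mult_ac)
      qed (auto intro!: continuous_on_diff cF)
      then show "dist (apply_bcontfun (Bcontfun (R u)) t) (apply_bcontfun (Bcontfun (R v)) t)
          \<le> 1 / 2 * dist u v"
        by (simp add: Bcontfun_inverse[OF R] R_def dist_norm integral_diff[OF int int]
            flip: scaleR_diff_right)
    qed
  qed auto
  then obtain u where "Bcontfun (R u) = u" by blast
  then have u: "apply_bcontfun u = R u" using Bcontfun_inverse[OF R[of u]] by simp
  define y where "y t = y0 + integral {0..t} (F u)" for t
  have Wu: "W t *\<^sub>R apply_bcontfun u t = y t" if "t \<ge> 0" for t
    using W1[OF that] that by (simp add: u R_def y_def max_def)
  have "(y has_vector_derivative F u t) (at t within {0..})" if "t \<ge> 0" for t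
    unfolding y_def
    by (rule has_vector_derivative_eq_rhs, rule has_vector_derivative_add,
        rule has_vector_derivative_const, rule integral_Ici_has_vector_derivative[OF cF that]) simp
  from C1_exI[OF cF this] obtain z where
    z: "\<And>t. t \<ge> 0 \<Longrightarrow> apply_C1 z t = y t" "\<And>t. t \<ge> 0 \<Longrightarrow> deriv_C1 z t = F u t" by metis
  show thesis
    by (rule that[of z]) (use z Wu in \<open>auto simp: y_def F_def\<close>)
qed

text \<open>
  The residual of the approximate solutions is measured relative to \<open>1 + |Y|\<close>: the part proportional
  to \<open>|Y|\<close> is absorbed into the growth constant of the Gronwall estimate, which therefore also shows
  that the approximate solutions stay bounded.
\<close>

lemma perturbed_linear_ode_tendsto:
  fixes A :: "real \<Rightarrow> 'f::banach \<Rightarrow>\<^sub>L 'f" and Y :: "'i \<Rightarrow> 'f C1"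
  assumes A: "continuous_on {0..} A"
    and y: "\<And>t. t \<ge> 0 \<Longrightarrow> deriv_C1 y t = blinfun_apply (A t) (apply_C1 y t) + b t"
    and Y0: "((\<lambda>i. apply_C1 (Y i) 0) \<longlongrightarrow> apply_C1 y 0) net"
    and Y: "\<And>T e. T > 0 \<Longrightarrow> e > 0 \<Longrightarrow> \<forall>\<^sub>F i in net. \<forall>t\<in>{0..T}.
      norm (deriv_C1 (Y i) t - blinfun_apply (A t) (apply_C1 (Y i) t) - b t)
        \<le> e * (1 + norm (apply_C1 (Y i) t))"
  shows "(Y \<longlongrightarrow> y) net"
proof (rule tendsto_C1I)
  fix T e :: real
  assume T: "T > 0" and e: "e > 0"
  have "bounded (A ` {0..T})"
    by (intro compact_imp_bounded compact_continuous_image continuous_on_subset[OF A]) auto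
  then obtain K where K: "K > 0" "\<And>t. t \<in> {0..T} \<Longrightarrow> norm (A t) \<le> K"
    unfolding bounded_pos by auto
  obtain r where r: "r > 0" "\<And>t. t \<in> {0..T} \<Longrightarrow> norm (apply_C1 y t) \<le> r"
    using compact_imp_bounded[OF compact_path[of y T]] unfolding bounded_pos by auto
  define L where "L = K + 1"
  define Q where "Q = (1 + (1 + r) * T) * exp (L * T)"
  \<comment> \<open>\<open>c Q\<close> will bound the difference of the paths, and \<open>c S\<close> also that of the derivatives.\<close>
  define S where "S = (L + 1) * Q + (1 + r)"
  have "L > 0" using K by (simp add: L_def)
  moreover have "Q > 0" using r T by (simp add: Q_def add_pos_pos)
  ultimately have pos: "L > 0" "Q > 0" "S > 0" using r by (simp_all add: S_def add_pos_pos)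
  define c where "c = min 1 (e / (2 * S))"
  have c: "c > 0" "c \<le> 1" using e pos by (auto simp: c_def)
  have "c * S \<le> e / 2"
    using pos mult_right_mono[of c "e / (2 * S)" S] by (auto simp: c_def)
  then have cS: "c * S < e" using e by simp
  have "\<forall>\<^sub>F i in net. norm (apply_C1 (Y i) 0 - apply_C1 y 0) < c"
    using tendstoD[OF Y0 c(1)] by (simp add: dist_norm)
  with Y[OF T c(1)]
  show "\<forall>\<^sub>F i in net. \<forall>t\<in>{0..T}. norm (apply_C1 (Y i) t - apply_C1 y t) < e \<and>
      norm (deriv_C1 (Y i) t - deriv_C1 y t) < e"
  proof eventually_elim
    case (elim i)
    define z where "z = Y i - y"
    have dz: "norm (deriv_C1 z t) \<le> L * norm (apply_C1 z t) + c * (1 + r)" if t: "t \<in> {0..T}" for t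
    proof -
      define \<rho> where "\<rho> = deriv_C1 (Y i) t - blinfun_apply (A t) (apply_C1 (Y i) t) - b t"
      have "norm (apply_C1 (Y i) t) \<le> norm (apply_C1 z t) + r"
        using norm_triangle_sub[of "apply_C1 (Y i) t" "apply_C1 y t"] r(2)[OF t] by (simp add: z_def)
      then have "norm \<rho> \<le> c * (1 + (norm (apply_C1 z t) + r))"
        using mult_left_mono[OF add_left_mono, of _ _ c 1] bspec[OF elim(1) t] c(1)
        unfolding \<rho>_def by (meson less_imp_le order_trans)
      also have "\<dots> \<le> norm (apply_C1 z t) + c * (1 + r)"
        using c mult_right_mono[of c 1 "norm (apply_C1 z t)"] by (simp add: algebra_simps)
      finally have "norm \<rho> \<le> norm (apply_C1 z t) + c * (1 + r)" .
      moreover have "norm (blinfun_apply (A t) (apply_C1 z t)) \<le> K * norm (apply_C1 z t)"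
        using K(2)[OF t] by (meson mult_right_mono norm_blinfun norm_ge_zero order_trans)
      moreover have "deriv_C1 z t = blinfun_apply (A t) (apply_C1 z t) + \<rho>"
        using t y[of t] by (simp add: \<rho>_def z_def deriv_C1_diff blinfun.diff_right)
      ultimately show ?thesis
        using norm_triangle_ineq[of "blinfun_apply (A t) (apply_C1 z t)" \<rho>]
        by (simp add: L_def algebra_simps)
    qed
    have z: "norm (apply_C1 z t) \<le> c * Q" if t: "t \<in> {0..T}" for t
    proof -
      have "norm (apply_C1 z t) \<le> (norm (apply_C1 z 0) + c * (1 + r) * T) * exp (L * T)"
        using pos c r dz t by (intro gronwall_C1) auto
      also have "\<dots> \<le> (c + c * (1 + r) * T) * exp (L * T)"
        using elim(2) by (intro mult_right_mono) (auto simp: z_def)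
      also have "\<dots> = c * Q" by (simp add: Q_def algebra_simps)
      finally show ?thesis .
    qed
    have split: "c * S = L * (c * Q) + c * Q + c * (1 + r)" by (simp add: S_def algebra_simps)
    have nonneg: "0 \<le> L * (c * Q)" "0 \<le> c * Q" "0 \<le> c * (1 + r)" using pos c r by auto
    show ?case
    proof (intro ballI conjI)
      fix t assume t: "t \<in> {0..T}"
      show "norm (apply_C1 (Y i) t - apply_C1 y t) < e"
        using z[OF t] split nonneg cS by (simp add: z_def)
      have "norm (deriv_C1 z t) \<le> L * (c * Q) + c * (1 + r)"
        using dz[OF t] z[OF t] pos by (meson add_right_mono mult_left_mono less_imp_le order_trans)
      then show "norm (deriv_C1 (Y i) t - deriv_C1 y t) < e"
        using t split nonneg cS by (simp add: z_def deriv_C1_diff)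
    qed
  qed
qed

lemma linear_ode_unique:
  fixes A :: "real \<Rightarrow> 'f::banach \<Rightarrow>\<^sub>L 'f"
  assumes A: "continuous_on {0..} A"
    and y: "\<And>t. t \<ge> 0 \<Longrightarrow> deriv_C1 y t = blinfun_apply (A t) (apply_C1 y t) + b t"
    and y': "\<And>t. t \<ge> 0 \<Longrightarrow> deriv_C1 y' t = blinfun_apply (A t) (apply_C1 y' t) + b t"
    and "apply_C1 y 0 = apply_C1 y' 0"
  shows "y = y'"
proof (rule C1_eqI)
  fix t :: real assume t: "t \<ge> 0"
  have "bounded (A ` {0..t})"
    by (intro compact_imp_bounded compact_continuous_image continuous_on_subset[OF A]) auto
  then obtain K where K: "K > 0" "\<And>s. s \<in> {0..t} \<Longrightarrow> norm (A s) \<le> K"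
    unfolding bounded_pos by auto
  have "norm (deriv_C1 (y - y') s) \<le> K * norm (apply_C1 (y - y') s) + 0" if s: "s \<in> {0..t}" for s
  proof -
    have "deriv_C1 (y - y') s = blinfun_apply (A s) (apply_C1 (y - y') s)"
      using s y y' by (simp add: deriv_C1_diff blinfun.diff_right)
    also have "norm \<dots> \<le> K * norm (apply_C1 (y - y') s)"
      using K(2)[OF s] by (meson mult_right_mono norm_blinfun norm_ge_zero order_trans)
    finally show ?thesis by simp
  qed
  from gronwall_C1[OF _ _ this, of t] show "apply_C1 y t = apply_C1 y' t"
    using K t assms(4) by simp
qed

section \<open>The linearised flow\<close>

lemma solves_linearised_iff:
  assumes "\<forall>p. extension_via \<iota> (frechet_derivative g (at p)) = blinfun_apply (A p)"
  shows "solves_linearised \<iota> g x y0 H y \<longleftrightarrow> apply_C1 y 0 = y0 \<and>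
    (\<forall>t\<ge>0. deriv_C1 y t = blinfun_apply (A (apply_C1 x t)) (apply_C1 y t) + apply_C0b H (apply_C1 x t))"
  unfolding solves_linearised_def assms[rule_format] ..

lemma continuous_on_compose_path:
  assumes "continuous_on UNIV f" shows "continuous_on {0..} (\<lambda>t. f (apply_C1 x t))"
  by (rule continuous_on_compose2[OF assms continuous_on_apply_C1]) simp

lemma continuous_on_apply_C0b: "continuous_on UNIV (apply_C0b H)"
  using apply_C0b[of H] by blast

lemma linearised_ex1:
  fixes \<iota> :: "'e::real_normed_vector \<Rightarrow> 'f::banach"
  assumes "dense_embedding \<iota>" "C1_via \<iota> g"
  shows "\<exists>!y. solves_linearised \<iota> g x y0 H y"
proof -
  obtain A :: "'e \<Rightarrow> 'f \<Rightarrow>\<^sub>L 'f" where A: "continuous_on UNIV A"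
    and "\<forall>p v. blinfun_apply (A p) (\<iota> v) = \<iota> (frechet_derivative g (at p) v)"
    and ext: "\<forall>p. extension_via \<iota> (frechet_derivative g (at p)) = blinfun_apply (A p)"
    by (rule C1_via_derivative_extension[OF assms])
  note cA = continuous_on_compose_path[OF A, of x]
  obtain y where "solves_linearised \<iota> g x y0 H y"
    unfolding solves_linearised_iff[OF ext]
    using linear_ode_exists[OF cA continuous_on_compose_path[OF continuous_on_apply_C0b[of H], of x], of y0]
    by metis
  moreover have "y = y'" if "solves_linearised \<iota> g x y0 H y" "solves_linearised \<iota> g x y0 H y'" for y y'
    using that unfolding solves_linearised_iff[OF ext]
    by (intro linear_ode_unique[OF cA, where b = "\<lambda>t. apply_C0b H (apply_C1 x t)"]) auto
  ultimately show ?thesis by blast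
qed

definition linearised_flow where
  "linearised_flow \<iota> g x z = (THE y. solves_linearised \<iota> g x (fst z) (snd z) y)"

lemma solves_linearised_flow:
  fixes \<iota> :: "'e::real_normed_vector \<Rightarrow> 'f::banach"
  assumes "dense_embedding \<iota>" "C1_via \<iota> g"
  shows "solves_linearised \<iota> g x (fst z) (snd z) (linearised_flow \<iota> g x z)"
    "solves_linearised \<iota> g x (fst z) (snd z) y \<Longrightarrow> y = linearised_flow \<iota> g x z"
proof -
  show "solves_linearised \<iota> g x (fst z) (snd z) (linearised_flow \<iota> g x z)"
    unfolding linearised_flow_def by (rule theI'[OF linearised_ex1[OF assms]])
  then show "solves_linearised \<iota> g x (fst z) (snd z) y \<Longrightarrow> y = linearised_flow \<iota> g x z"
    using linearised_ex1[OF assms] by blast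
qed

lemma continuous_on_linearised_flow:
  fixes \<iota> :: "'e::real_normed_vector \<Rightarrow> 'f::banach"
  assumes "dense_embedding \<iota>" "C1_via \<iota> g"
  shows "continuous_on UNIV (linearised_flow \<iota> g x)"
  unfolding continuous_on_def
proof
  fix z :: "'f \<times> ('e, 'f) C0b"
  obtain A :: "'e \<Rightarrow> 'f \<Rightarrow>\<^sub>L 'f" where A: "continuous_on UNIV A"
    and "\<forall>p v. blinfun_apply (A p) (\<iota> v) = \<iota> (frechet_derivative g (at p) v)"
    and ext: "\<forall>p. extension_via \<iota> (frechet_derivative g (at p)) = blinfun_apply (A p)"
    by (rule C1_via_derivative_extension[OF assms])
  note sol = solves_linearised_flow(1)[OF assms, of x, unfolded solves_linearised_iff[OF ext]]
  show "(linearised_flow \<iota> g x \<longlongrightarrow> linearised_flow \<iota> g x z) (at z)"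
  proof (rule perturbed_linear_ode_tendsto[OF continuous_on_compose_path[OF A, of x]])
    show "\<And>t. t \<ge> 0 \<Longrightarrow> deriv_C1 (linearised_flow \<iota> g x z) t =
        blinfun_apply (A (apply_C1 x t)) (apply_C1 (linearised_flow \<iota> g x z) t) +
        apply_C0b (snd z) (apply_C1 x t)"
      using sol by blast
    show "((\<lambda>z. apply_C1 (linearised_flow \<iota> g x z) 0) \<longlongrightarrow> apply_C1 (linearised_flow \<iota> g x z) 0) (at z)"
      using sol by (simp add: tendsto_fst[OF tendsto_ident_at])
    fix T e :: real assume T: "T > 0" and e: "e > 0"
    have "(snd \<longlongrightarrow> snd z) (at z)" by (rule tendsto_snd[OF tendsto_ident_at])
    then have "\<forall>\<^sub>F w in at z. \<forall>q\<in>apply_C1 x ` {0..T}. dist (apply_C0b (snd w) q) (apply_C0b (snd z) q) < e"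
      using compact_imp_bounded[OF compact_path[of x T]] e uniform_limitD
      unfolding tendsto_C0b_iff by blast
    then show "\<forall>\<^sub>F w in at z. \<forall>t\<in>{0..T}. norm (deriv_C1 (linearised_flow \<iota> g x w) t -
        blinfun_apply (A (apply_C1 x t)) (apply_C1 (linearised_flow \<iota> g x w) t) -
        apply_C0b (snd z) (apply_C1 x t)) \<le> e * (1 + norm (apply_C1 (linearised_flow \<iota> g x w) t))"
    proof eventually_elim
      case (elim w)
      show ?case
      proof
        fix t assume t: "t \<in> {0..T}"
        have "norm (apply_C0b (snd w) (apply_C1 x t) - apply_C0b (snd z) (apply_C1 x t)) \<le> e"
          using elim t by (force simp: dist_norm)
        moreover have "0 \<le> e * norm (apply_C1 (linearised_flow \<iota> g x w) t)" using e by simp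
        ultimately show "norm (deriv_C1 (linearised_flow \<iota> g x w) t -
          blinfun_apply (A (apply_C1 x t)) (apply_C1 (linearised_flow \<iota> g x w) t) -
          apply_C0b (snd z) (apply_C1 x t)) \<le> e * (1 + norm (apply_C1 (linearised_flow \<iota> g x w) t))"
          using sol t by (simp add: algebra_simps)
      qed
    qed
  qed
qed

lemma linear_linearised_flow:
  fixes \<iota> :: "'e::real_normed_vector \<Rightarrow> 'f::banach"
  assumes "dense_embedding \<iota>" "C1_via \<iota> g"
  shows "linear (linearised_flow \<iota> g x)"
proof -
  obtain A :: "'e \<Rightarrow> 'f \<Rightarrow>\<^sub>L 'f" where "continuous_on UNIV A"
    and "\<forall>p v. blinfun_apply (A p) (\<iota> v) = \<iota> (frechet_derivative g (at p) v)"
    and ext: "\<forall>p. extension_via \<iota> (frechet_derivative g (at p)) = blinfun_apply (A p)"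
    by (rule C1_via_derivative_extension[OF assms])
  note sol = solves_linearised_flow(1)[OF assms, of x, unfolded solves_linearised_iff[OF ext]]
    and unique = solves_linearised_flow(2)[OF assms, of x, unfolded solves_linearised_iff[OF ext], symmetric]
  show ?thesis
  proof (rule linearI)
    show "linearised_flow \<iota> g x (z + w) = linearised_flow \<iota> g x z + linearised_flow \<iota> g x w" for z w
      using sol[of z] sol[of w] by (intro unique) (simp add: deriv_C1_add blinfun.add_right)
    show "linearised_flow \<iota> g x (c *\<^sub>R z) = c *\<^sub>R linearised_flow \<iota> g x z" for c z
      using sol[of z]
      by (intro unique) (simp add: deriv_C1_scaleR blinfun.scaleR_right scaleR_add_right)
  qed
qed

section \<open>First-order expansion of the flow\<close>

text \<open>
  The residual of \<open>c (X - x)\<close> in the linearised equation has three parts: the linearisation error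
  of \<open>g\<close>, the difference of the field fluctuation and its limit \<open>H\<close>, evaluated at \<open>X\<close>, and the
  displacement of \<open>H\<close> from \<open>x\<close> to \<open>X\<close>. The displacement is measured in the smaller space, where
  \<open>X\<close> tends to \<open>x\<close>, and the linearisation error is small relative to \<open>c (X - x)\<close>.
\<close>

lemma flow_first_order:
  fixes \<iota> :: "'e::banach \<Rightarrow> 'f::banach" and g :: "('e, 'e) C0b"
  assumes emb: "dense_embedding \<iota>" and g: "C1_via \<iota> (apply_C0b g)"
    and lip: "\<And>p. \<exists>u>0. \<exists>L. L-lipschitz_on (cball p u) (apply_C0b g)"
    and x: "solves (apply_C0b g) x0 x"
    and y: "solves_linearised \<iota> (apply_C0b g) x y0 H y"
    and X: "\<forall>\<^sub>F i in net. solves (apply_C0b (G i)) (\<xi> i) (X i)"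
    and \<xi>: "(\<xi> \<longlongrightarrow> x0) net" and G: "(G \<longlongrightarrow> g) net"
    and y0: "((\<lambda>i. c i *\<^sub>R \<iota> (\<xi> i - x0)) \<longlongrightarrow> y0) net"
    and H: "((\<lambda>i. c i *\<^sub>R C0b_map \<iota> (G i - g)) \<longlongrightarrow> H) net"
  shows "((\<lambda>i. c i *\<^sub>R C1_map \<iota> (X i - x)) \<longlongrightarrow> y) net"
proof -
  have \<iota>: "bounded_linear \<iota>" by (rule dense_embedding_bounded_linear[OF emb])
  interpret bounded_linear \<iota> by (rule \<iota>)
  obtain A :: "'e \<Rightarrow> 'f \<Rightarrow>\<^sub>L 'f" where A: "continuous_on UNIV A"
    and AD: "\<forall>p v. blinfun_apply (A p) (\<iota> v) = \<iota> (frechet_derivative (apply_C0b g) (at p) v)"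
    and ext: "\<forall>p. extension_via \<iota> (frechet_derivative (apply_C0b g) (at p)) = blinfun_apply (A p)"
    by (rule C1_via_derivative_extension[OF emb g])
  have gdiff: "\<And>p. apply_C0b g differentiable (at p)" using g by (simp add: C1_via_def)
  note y = y[unfolded solves_linearised_iff[OF ext]]
  have Xx: "(X \<longlongrightarrow> x) net" by (rule flow_stable[OF lip x X \<xi> G])
  show ?thesis
  proof (rule perturbed_linear_ode_tendsto[OF continuous_on_compose_path[OF A, of x]])
    show "\<And>t. t \<ge> 0 \<Longrightarrow> deriv_C1 y t =
        blinfun_apply (A (apply_C1 x t)) (apply_C1 y t) + apply_C0b H (apply_C1 x t)"
      using y by blast
    have "\<forall>\<^sub>F i in net. c i *\<^sub>R \<iota> (\<xi> i - x0) = apply_C1 (c i *\<^sub>R C1_map \<iota> (X i - x)) 0"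
      using X by eventually_elim (use x in \<open>simp add: solves_def apply_C1_map[OF \<iota>]\<close>)
    from Lim_transform_eventually[OF y0 this] show
      "((\<lambda>i. apply_C1 (c i *\<^sub>R C1_map \<iota> (X i - x)) 0) \<longlongrightarrow> apply_C1 y 0) net"
      using y by simp
  next
    fix T e :: real assume T: "T > 0" and e: "e > 0"
    let ?C = "apply_C1 x ` {0..T}"
    obtain d1 where d1: "d1 > 0" "\<And>p q. p \<in> ?C \<Longrightarrow> dist q p < d1 \<Longrightarrow> dist (A q) (A p) < e"
      using continuous_uniformly_near_compact[OF A compact_path e] by metis
    obtain d2 where d2: "d2 > 0"
      "\<And>p q. p \<in> ?C \<Longrightarrow> dist q p < d2 \<Longrightarrow> dist (apply_C0b H q) (apply_C0b H p) < e / 2"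
      using continuous_uniformly_near_compact[OF continuous_on_apply_C0b[of H] compact_path[of x T], of "e / 2"] e
      by (metis half_gt_zero)
    define d where "d = min d1 d2"
    have d: "d > 0" using d1 d2 by (simp add: d_def)
    define B where "B = {q. \<exists>p\<in>?C. dist q p \<le> d}"
    have B: "bounded B"
      unfolding B_def by (rule bounded_tube) (rule compact_imp_bounded[OF compact_path])
    have "uniform_limit B (\<lambda>i. apply_C0b (c i *\<^sub>R C0b_map \<iota> (G i - g))) (apply_C0b H) net"
      using H B unfolding tendsto_C0b_iff by blast
    from uniform_limitD[OF this half_gt_zero[OF e]]
    have "\<forall>\<^sub>F i in net. \<forall>q\<in>B. dist (apply_C0b (c i *\<^sub>R C0b_map \<iota> (G i - g)) q) (apply_C0b H q) < e / 2" .
    with tendsto_C1D[OF Xx d, of T] X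
    show "\<forall>\<^sub>F i in net. \<forall>t\<in>{0..T}. norm (deriv_C1 (c i *\<^sub>R C1_map \<iota> (X i - x)) t -
        blinfun_apply (A (apply_C1 x t)) (apply_C1 (c i *\<^sub>R C1_map \<iota> (X i - x)) t) -
        apply_C0b H (apply_C1 x t)) \<le> e * (1 + norm (apply_C1 (c i *\<^sub>R C1_map \<iota> (X i - x)) t))"
    proof eventually_elim
      case (elim i)
      show ?case
      proof
        fix t assume t: "t \<in> {0..T}"
        define p where "p = apply_C1 x t"
        define h where "h = apply_C1 (X i) t - p"
        have p: "p \<in> ?C" using t by (auto simp: p_def)
        have h: "norm h < d" using elim(1) t by (auto simp: h_def p_def)
        have Xt: "apply_C1 (X i) t = p + h" by (simp add: h_def)
        define r1 where "r1 = \<iota> (apply_C0b g (p + h)) - \<iota> (apply_C0b g p) - blinfun_apply (A p) (\<iota> h)"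
        define r2 where "r2 = c i *\<^sub>R \<iota> (apply_C0b (G i) (p + h) - apply_C0b g (p + h)) - apply_C0b H (p + h)"
        define r3 where "r3 = apply_C0b H (p + h) - apply_C0b H p"
        have "norm r1 \<le> e * norm (\<iota> h)"
          unfolding r1_def
        proof (rule scaled_increment_bound[OF \<iota> gdiff AD])
          fix s :: real assume s: "s \<in> {0..1}"
          have "norm (s *\<^sub>R h) \<le> 1 * norm h" using s unfolding norm_scaleR by (intro mult_right_mono) auto
          then have "dist (p + s *\<^sub>R h) p < d1" using h by (simp add: dist_norm d_def)
          from d1(2)[OF p this] show "norm (A (p + s *\<^sub>R h) - A p) \<le> e" by (simp add: dist_norm)
        qed
        then have n1: "norm (c i *\<^sub>R r1) \<le> e * norm (c i *\<^sub>R \<iota> h)"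
          using mult_left_mono[of "norm r1" "e * norm (\<iota> h)" "\<bar>c i\<bar>"] by (simp add: mult_ac)
        have n2: "norm r2 < e / 2"
        proof -
          have "p + h \<in> B" unfolding B_def using h by (intro CollectI bexI[OF _ p]) (simp add: dist_norm)
          then show ?thesis using elim(3) by (auto simp: r2_def dist_norm apply_C0b_map[OF \<iota>])
        qed
        have n3: "norm r3 < e / 2"
          using d2(2)[OF p, of "p + h"] h by (simp add: r3_def dist_norm d_def)
        have aY: "apply_C1 (c i *\<^sub>R C1_map \<iota> (X i - x)) t = c i *\<^sub>R \<iota> h"
          by (simp add: apply_C1_map[OF \<iota>] h_def p_def)
        have residual: "deriv_C1 (c i *\<^sub>R C1_map \<iota> (X i - x)) t -
            blinfun_apply (A p) (apply_C1 (c i *\<^sub>R C1_map \<iota> (X i - x)) t) - apply_C0b H p =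
            c i *\<^sub>R r1 + r2 + r3"
        proof -
          have "deriv_C1 (c i *\<^sub>R C1_map \<iota> (X i - x)) t =
              c i *\<^sub>R (\<iota> (apply_C0b (G i) (p + h)) - \<iota> (apply_C0b g p))"
            using t elim(2) x
            by (simp add: deriv_C1_scaleR deriv_C1_map[OF \<iota>] deriv_C1_diff solves_def Xt p_def[symmetric] diff)
          then show ?thesis
            unfolding aY by (simp add: r1_def r2_def r3_def blinfun.scaleR_right diff scaleR_diff_right)
        qed
        have "norm (c i *\<^sub>R r1 + r2 + r3) \<le> e * (1 + norm (c i *\<^sub>R \<iota> h))"
          using n1 n2 n3 norm_triangle_ineq[of "c i *\<^sub>R r1 + r2" r3] norm_triangle_ineq[of "c i *\<^sub>R r1" r2]
          unfolding distrib_left mult_1_right by linarith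
        then show "norm (deriv_C1 (c i *\<^sub>R C1_map \<iota> (X i - x)) t -
            blinfun_apply (A (apply_C1 x t)) (apply_C1 (c i *\<^sub>R C1_map \<iota> (X i - x)) t) -
            apply_C0b H (apply_C1 x t)) \<le> e * (1 + norm (apply_C1 (c i *\<^sub>R C1_map \<iota> (X i - x)) t))"
          unfolding p_def[symmetric] residual by (simp only: aY)
      qed
    qed
  qed
qed

section \<open>Seminorm distances on the data\<close>

definition C0b_dist where
  "C0b_dist k h h' = (SUP p\<in>cball 0 (real k). dist (apply_C0b h p) (apply_C0b h' p))"

lemma C0b_dist_upper:
  assumes "p \<in> cball 0 (real k)"
  shows "dist (apply_C0b h p) (apply_C0b h' p) \<le> C0b_dist k h h'"
proof -
  have "bounded (apply_C0b h ` cball 0 (real k))" "bounded (apply_C0b h' ` cball 0 (real k))"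
    using apply_C0b[of h] apply_C0b[of h'] by auto
  then show ?thesis
    unfolding C0b_dist_def using assms
    by (intro cSUP_upper bounded_imp_bdd_above bounded_dist_comp) auto
qed

lemma C0b_dist_least:
  assumes "\<And>p. p \<in> cball 0 (real k) \<Longrightarrow> dist (apply_C0b h p) (apply_C0b h' p) \<le> c"
  shows "C0b_dist k h h' \<le> c"
  unfolding C0b_dist_def using assms by (intro cSUP_least) auto

text \<open>
  Increasing pseudometrics which together define the topology of the product.
\<close>

definition data_dist ::
    "nat \<Rightarrow> 'a::metric_space \<times> ('b::real_normed_vector, 'c::real_normed_vector) C0b \<Rightarrow>
      'a \<times> ('b, 'c) C0b \<Rightarrow> real"
  where "data_dist k z w = dist (fst z) (fst w) + C0b_dist k (snd z) (snd w)"

lemma C0b_dist_nonneg: "0 \<le> C0b_dist k h h'"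
  by (rule order_trans[OF zero_le_dist C0b_dist_upper[of 0]]) simp

lemma data_dist_nonneg: "0 \<le> data_dist k z w"
  unfolding data_dist_def by (intro add_nonneg_nonneg zero_le_dist C0b_dist_nonneg)

lemma data_dist_self: "data_dist k z z = 0"
  using C0b_dist_nonneg[of k "snd z" "snd z"] C0b_dist_least[of k "snd z" "snd z" 0]
  by (simp add: data_dist_def)

lemma data_dist_commute: "data_dist k z w = data_dist k w z"
  by (simp add: data_dist_def C0b_dist_def dist_commute)

lemma data_dist_triangle:
  fixes z w u :: "'a::metric_space \<times> ('b::real_normed_vector, 'c::real_normed_vector) C0b"
  shows "data_dist k z u \<le> data_dist k z w + data_dist k w u"
proof -
  have "C0b_dist k (snd z) (snd u) \<le> C0b_dist k (snd z) (snd w) + C0b_dist k (snd w) (snd u)"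
  proof (rule C0b_dist_least)
    fix p :: 'b assume p: "p \<in> cball 0 (real k)"
    show "dist (apply_C0b (snd z) p) (apply_C0b (snd u) p) \<le>
        C0b_dist k (snd z) (snd w) + C0b_dist k (snd w) (snd u)"
      using C0b_dist_upper[OF p, of "snd z" "snd w"] C0b_dist_upper[OF p, of "snd w" "snd u"]
        dist_triangle[of "apply_C0b (snd z) p" "apply_C0b (snd u) p" "apply_C0b (snd w) p"]
      by linarith
  qed
  then show ?thesis
    unfolding data_dist_def using dist_triangle[of "fst z" "fst u" "fst w"] by linarith
qed

lemma data_dist_tendsto_0: "(data_dist k z \<longlongrightarrow> 0) (nhds z)"
proof -
  have id: "((\<lambda>w. w) \<longlongrightarrow> z) (nhds z)" by (simp add: filterlim_ident)
  have "((\<lambda>w. C0b_dist k (snd z) (snd w)) \<longlongrightarrow> 0) (nhds z)"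
  proof (rule tendstoI)
    fix e :: real assume e: "e > 0"
    have "uniform_limit (cball 0 (real k)) (\<lambda>w. apply_C0b (snd w)) (apply_C0b (snd z)) (nhds z)"
      using tendsto_snd[OF id] unfolding tendsto_C0b_iff by auto
    from uniform_limitD[OF this half_gt_zero[OF e]]
    show "\<forall>\<^sub>F w in nhds z. dist (C0b_dist k (snd z) (snd w)) 0 < e"
    proof eventually_elim
      case (elim w)
      have "C0b_dist k (snd z) (snd w) \<le> e / 2"
        using elim by (intro C0b_dist_least) (simp add: dist_commute less_imp_le)
      then show ?case using e C0b_dist_nonneg[of k "snd z" "snd w"] by simp
    qed
  qed
  moreover have "((\<lambda>w. dist (fst z) (fst w)) \<longlongrightarrow> 0) (nhds z)"
    using tendsto_dist[OF tendsto_const tendsto_fst[OF id], of "fst z"] by simp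
  ultimately have "((\<lambda>w. dist (fst z) (fst w) + C0b_dist k (snd z) (snd w)) \<longlongrightarrow> 0 + 0) (nhds z)"
    by (intro tendsto_add)
  then show ?thesis by (simp add: data_dist_def[abs_def])
qed

text \<open>
  The index of the pseudometric runs with the sequence: since the balls increase, the distances of
  large index dominate each fixed one.
\<close>

lemma tendsto_data_distI:
  assumes F: "F \<le> sequentially" and lim: "((\<lambda>k. data_dist k z (w k)) \<longlongrightarrow> 0) F"
  shows "(w \<longlongrightarrow> z) F"
proof -
  have "((\<lambda>k. dist (fst (w k)) (fst z)) \<longlongrightarrow> 0) F"
    by (rule tendsto_sandwich[OF _ _ tendsto_const lim])
      (simp_all add: data_dist_def C0b_dist_nonneg dist_commute)
  then have "((\<lambda>k. fst (w k)) \<longlongrightarrow> fst z) F" by (rule tendsto_dist_iff[THEN iffD2])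
  moreover have "((\<lambda>k. snd (w k)) \<longlongrightarrow> snd z) F"
    unfolding tendsto_C0b_iff
  proof (intro allI impI uniform_limitI)
    fix B :: "'b set" and e :: real
    assume "bounded B" and e: "e > 0"
    then obtain r where r: "\<And>p. p \<in> B \<Longrightarrow> norm p \<le> r" unfolding bounded_iff by blast
    obtain m where m: "r \<le> real m" using real_arch_simple by blast
    have "\<forall>\<^sub>F k in F. m \<le> k" using eventually_ge_at_top F by (rule filter_leD[rotated])
    moreover have "\<forall>\<^sub>F k in F. data_dist k z (w k) < e" by (rule order_tendstoD(2)[OF lim e])
    ultimately show "\<forall>\<^sub>F k in F. \<forall>p\<in>B. dist (apply_C0b (snd (w k)) p) (apply_C0b (snd z) p) < e"
    proof eventually_elim
      case (elim k)
      show ?case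
      proof
        fix p assume "p \<in> B"
        then have "p \<in> cball 0 (real k)" using r[of p] m elim(1) by simp
        from C0b_dist_upper[OF this, of "snd z" "snd (w k)"]
        show "dist (apply_C0b (snd (w k)) p) (apply_C0b (snd z) p) < e"
          using elim(2) zero_le_dist[of "fst z" "fst (w k)"]
          unfolding data_dist_def dist_commute[of "apply_C0b (snd (w k)) p"] by linarith
      qed
    qed
  qed
  ultimately have "((\<lambda>k. (fst (w k), snd (w k))) \<longlongrightarrow> (fst z, snd z)) F" by (rule tendsto_Pair)
  then show ?thesis by simp
qed

lemma continuous_on_data_dist: "continuous_on UNIV (data_dist k z)"
  unfolding continuous_on_def
proof
  fix w
  have le: "norm (data_dist k z u - data_dist k z w) \<le> data_dist k w u" for u
    using data_dist_triangle[of k z u w] data_dist_triangle[of k z w u]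
    by (simp add: data_dist_commute[of k u w] abs_le_iff)
  have lim: "(data_dist k w \<longlongrightarrow> 0) (at w)"
    using data_dist_tendsto_0 by (rule tendsto_mono[rotated]) (simp add: at_within_le_nhds)
  have "((\<lambda>u. data_dist k z u - data_dist k z w) \<longlongrightarrow> 0) (at w)"
    by (rule Lim_null_comparison[OF _ lim]) (intro always_eventually allI le)
  then show "(data_dist k z \<longlongrightarrow> data_dist k z w) (at w)" by (rule LIM_zero_cancel)
qed

section \<open>An extended continuous mapping theorem\<close>

text \<open>
  \<open>J k w\<close> is the set of values compatible with the parameter \<open>w\<close> at precision \<open>k\<close>, and \<open>\<Psi>\<close> is their
  limit. The sup-convolution \<open>G k z\<close> of \<open>f\<close> with the penalty \<open>k q\<^sub>k\<close> is Lipschitz for \<open>q\<^sub>k\<close>. If it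
  exceeded \<open>f (\<Psi> z) + \<delta>\<close> for infinitely many \<open>k\<close>, boundedness of \<open>f\<close> would force near-optimal
  parameters to converge to \<open>z\<close>, hence the values to \<open>\<Psi> z\<close>, a contradiction. The maximum with
  \<open>f (\<Psi> z)\<close> turns this upper bound into convergence. The hypotheses are stated for filters finer than
  \<open>sequentially\<close> in order to cover the passage to the exceptional \<open>k\<close>.
\<close>

lemma upper_envelopes:
  fixes q :: "nat \<Rightarrow> 's::topological_space \<Rightarrow> 's \<Rightarrow> real"
    and \<Psi> :: "'s \<Rightarrow> 't::topological_space" and f :: "'t \<Rightarrow> real"
  assumes f: "continuous_on UNIV f" and C: "\<And>y. - C \<le> f y" "\<And>y. f y \<le> C"
    and q: "\<And>k z w. 0 \<le> q k z w" "\<And>k z. q k z z = 0" "\<And>k z w. q k z w = q k w z"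
      "\<And>k z w u. q k z u \<le> q k z w + q k w u" "\<And>k z. (q k z \<longlongrightarrow> 0) (nhds z)"
      "\<And>F z w. F \<le> sequentially \<Longrightarrow> ((\<lambda>k. q k z (w k)) \<longlongrightarrow> 0) F \<Longrightarrow> (w \<longlongrightarrow> z) F"
    and \<Psi>: "continuous_on UNIV \<Psi>"
    and J: "\<And>F z w y. F \<le> sequentially \<Longrightarrow> (w \<longlongrightarrow> z) F \<Longrightarrow> \<forall>\<^sub>F k in F. y k \<in> J k (w k) \<Longrightarrow>
      (y \<longlongrightarrow> \<Psi> z) F"
  shows "\<exists>H. (\<forall>k. continuous_on UNIV (H k)) \<and> (\<forall>k z. \<bar>H k z\<bar> \<le> C) \<and>
    (\<forall>k z. \<forall>y\<in>J k z. f y \<le> H k z) \<and> (\<forall>z. (\<lambda>k. H k z) \<longlonglongrightarrow> f (\<Psi> z))"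
proof -
  have C0: "0 \<le> C" using C[of undefined] by linarith
  have f\<Psi>: "continuous_on UNIV (\<lambda>z. f (\<Psi> z))"
    by (rule continuous_on_compose2[OF f \<Psi>]) simp
  define V where "V k z = insert (- C) {f y - real k * q k z w | w y. y \<in> J k w}" for k z
  define G where "G k z = Sup (V k z)" for k z
  have V_le: "v \<le> C" if v: "v \<in> V k z" for v k z
  proof -
    consider "v = - C" | w y where "v = f y - real k * q k z w" using v unfolding V_def by blast
    then show ?thesis
    proof cases
      case 2
      have "0 \<le> real k * q k z w" using q(1) by simp
      then show ?thesis using 2 C(2)[of y] by linarith
    qed (use C0 in simp)
  qed
  then have bdd: "bdd_above (V k z)" for k z by (meson bdd_aboveI)
  have G_upper: "v \<le> G k z" if "v \<in> V k z" for v k z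
    unfolding G_def using that bdd by (rule cSup_upper)
  have G_least: "G k z \<le> c" if "\<And>v. v \<in> V k z \<Longrightarrow> v \<le> c" for c k z
    unfolding G_def using that by (intro cSup_least) (auto simp: V_def)
  have G_bounds: "- C \<le> G k z" "G k z \<le> C" for k z
    using V_le by (auto intro!: G_upper G_least simp: V_def)
  have G_lipschitz: "G k z \<le> G k u + real k * q k z u" for k z u
  proof (rule G_least)
    fix v assume "v \<in> V k z"
    then consider "v = - C" | w y where "y \<in> J k w" "v = f y - real k * q k z w" unfolding V_def by blast
    then show "v \<le> G k u + real k * q k z u"
    proof cases
      case 1
      have "0 \<le> real k * q k z u" using q(1) by simp
      then show ?thesis using 1 G_bounds(1)[of k u] by linarith
    next
      case 2
      have "f y - real k * q k u w \<le> G k u" using 2(1) by (intro G_upper) (auto simp: V_def)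
      moreover have "real k * q k u w \<le> real k * (q k z u + q k z w)"
        using q(4)[where k = k and z = u and w = z and u = w] q(3)[of k u z] by (intro mult_left_mono) auto
      ultimately show ?thesis using 2(2) by (simp add: algebra_simps)
    qed
  qed
  have G_cont: "continuous_on UNIV (G k)" for k
    unfolding continuous_on_def
  proof
    fix z
    have le: "norm (G k u - G k z) \<le> real k * q k z u" for u
      using G_lipschitz[of k z u] G_lipschitz[of k u z] q(3)[of k u z] by (simp add: abs_le_iff)
    have "(q k z \<longlongrightarrow> 0) (at z)"
      by (rule tendsto_mono[OF _ q(5)]) (simp add: at_within_le_nhds)
    then have lim: "((\<lambda>u. real k * q k z u) \<longlongrightarrow> 0) (at z)"
      by (rule tendsto_mult_right_zero)
    have "((\<lambda>u. G k u - G k z) \<longlongrightarrow> 0) (at z)"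
      by (rule Lim_null_comparison[OF _ lim]) (intro always_eventually allI le)
    then show "(G k \<longlongrightarrow> G k z) (at z)" by (rule LIM_zero_cancel)
  qed
  have G_limsup: "\<forall>\<^sub>F k in sequentially. G k z \<le> f (\<Psi> z) + \<delta>" if \<delta>: "\<delta> > 0" for z \<delta>
  proof (rule ccontr)
    define bad where "bad = {k. \<not> G k z \<le> f (\<Psi> z) + \<delta>}"
    define F where "F = inf sequentially (principal bad)"
    assume "\<not> (\<forall>\<^sub>F k in sequentially. G k z \<le> f (\<Psi> z) + \<delta>)"
    then have F_bot: "F \<noteq> bot"
      by (auto simp: F_def bad_def trivial_limit_def eventually_inf_principal)
    have F_le: "F \<le> sequentially" by (simp add: F_def)
    have F_bad: "\<forall>\<^sub>F k in F. k \<in> bad" by (simp add: F_def eventually_inf_principal)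
    have "\<exists>w y. y \<in> J k w \<and> f (\<Psi> z) + \<delta> < f y - real k * q k z w" if "k \<in> bad" for k
    proof -
      have "\<exists>v\<in>V k z. f (\<Psi> z) + \<delta> < v"
        using that G_least[of k z "f (\<Psi> z) + \<delta>"] unfolding bad_def by (fastforce simp: not_le)
      then obtain v where v: "v \<in> V k z" "f (\<Psi> z) + \<delta> < v" by blast
      moreover have "v \<noteq> - C" using v(2) C(1)[of "\<Psi> z"] \<delta> by auto
      ultimately show ?thesis by (auto simp: V_def)
    qed
    then obtain w y where wy: "\<And>k. k \<in> bad \<Longrightarrow> y k \<in> J k (w k)"
      "\<And>k. k \<in> bad \<Longrightarrow> f (\<Psi> z) + \<delta> < f (y k) - real k * q k z (w k)"
      by metis
    have small: "q k z (w k) \<le> 2 * C / real k" if "k \<in> bad" "k > 0" for k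
    proof -
      have "real k * q k z (w k) \<le> 2 * C"
        using wy(2)[OF that(1)] C(1)[of "\<Psi> z"] C(2)[of "y k"] \<delta> by linarith
      then show ?thesis using that(2) by (simp add: field_simps)
    qed
    have "((\<lambda>k. 2 * C / real k) \<longlongrightarrow> 0) F"
      by (rule tendsto_mono[OF F_le lim_const_over_n])
    note lim = this
    have "((\<lambda>k. q k z (w k)) \<longlongrightarrow> 0) F"
    proof (rule tendsto_sandwich[OF _ _ tendsto_const lim])
      have "\<forall>\<^sub>F k in F. k > 0" using eventually_gt_at_top F_le by (rule filter_leD[rotated])
      then show "\<forall>\<^sub>F k in F. q k z (w k) \<le> 2 * C / real k"
        using F_bad by eventually_elim (rule small)
    qed (simp add: q(1))
    then have "(w \<longlongrightarrow> z) F" by (rule q(6)[OF F_le])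
    moreover have "\<forall>\<^sub>F k in F. y k \<in> J k (w k)" using F_bad by eventually_elim (rule wy(1))
    ultimately have "(y \<longlongrightarrow> \<Psi> z) F" by (rule J[OF F_le])
    then have "((\<lambda>k. f (y k)) \<longlongrightarrow> f (\<Psi> z)) F"
      using f by (intro continuous_on_tendsto_compose[of UNIV f]) auto
    from order_tendstoD(2)[OF this, of "f (\<Psi> z) + \<delta>"] \<delta>
    have "\<forall>\<^sub>F k in F. f (y k) < f (\<Psi> z) + \<delta>" by simp
    with F_bad have "\<forall>\<^sub>F k in F. False"
    proof eventually_elim
      case (elim k)
      have "0 \<le> real k * q k z (w k)" using q(1) by simp
      then show ?case using wy(2)[OF elim(1)] elim(2) by linarith
    qed
    then show False using F_bot by (simp add: eventually_False)
  qed

  define H where "H k z = max (f (\<Psi> z)) (G k z)" for k z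
  have H_cont: "continuous_on UNIV (H k)" for k
    unfolding H_def by (intro continuous_on_max f\<Psi> G_cont)
  have H_bound: "\<bar>H k z\<bar> \<le> C" for k z
    using C[of "\<Psi> z"] G_bounds[of k z] by (auto simp: H_def max_def abs_le_iff)
  have H_lim: "(\<lambda>k. H k z) \<longlonglongrightarrow> f (\<Psi> z)" for z
  proof (rule order_tendstoI)
    fix a assume "a < f (\<Psi> z)"
    then show "\<forall>\<^sub>F k in sequentially. a < H k z" by (simp add: H_def less_max_iff_disj)
  next
    fix a assume a: "f (\<Psi> z) < a"
    then have "\<forall>\<^sub>F k in sequentially. G k z \<le> f (\<Psi> z) + (a - f (\<Psi> z)) / 2"
      by (intro G_limsup) simp
    then show "\<forall>\<^sub>F k in sequentially. H k z < a"
      by eventually_elim (use a in \<open>auto simp: H_def field_simps\<close>)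
  qed
  have "f y \<le> H k z" if "y \<in> J k z" for y k z
  proof -
    have "f y - real k * q k z z \<le> G k z" using that by (intro G_upper) (auto simp: V_def)
    then show ?thesis by (simp add: q(2) H_def)
  qed
  then show ?thesis using H_cont H_bound H_lim by blast
qed

text \<open>
  The variables \<open>Y n\<close> are not functions of \<open>Z n\<close>; they are only known to be compatible with \<open>Z n\<close> at
  precision \<open>k\<close>, off sets \<open>B k n\<close> of vanishing probability. The upper estimate for \<open>-f\<close> is the lower
  estimate for \<open>f\<close>.
\<close>

lemma extended_continuous_mapping:
  fixes q :: "nat \<Rightarrow> 's::topological_space \<Rightarrow> 's \<Rightarrow> real"
    and \<Psi> :: "'s \<Rightarrow> 't::topological_space"
  assumes M: "prob_space M" and N: "prob_space N"
    and conv: "converges_in_distribution M Z N Zlim"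
    and q: "\<And>k z w. 0 \<le> q k z w" "\<And>k z. q k z z = 0" "\<And>k z w. q k z w = q k w z"
      "\<And>k z w u. q k z u \<le> q k z w + q k w u" "\<And>k z. (q k z \<longlongrightarrow> 0) (nhds z)"
      "\<And>F z w. F \<le> sequentially \<Longrightarrow> ((\<lambda>k. q k z (w k)) \<longlongrightarrow> 0) F \<Longrightarrow> (w \<longlongrightarrow> z) F"
    and \<Psi>: "continuous_on UNIV \<Psi>"
    and J: "\<And>F z w y. F \<le> sequentially \<Longrightarrow> (w \<longlongrightarrow> z) F \<Longrightarrow> \<forall>\<^sub>F k in F. y k \<in> J k (w k) \<Longrightarrow>
      (y \<longlongrightarrow> \<Psi> z) F"
    and Y: "\<And>n. Y n \<in> borel_measurable M"
    and B: "\<And>k n. B k n \<in> sets M" "\<And>k. (\<lambda>n. measure M (B k n)) \<longlonglongrightarrow> 0"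
    and YJ: "\<And>k. \<forall>\<^sub>F n in sequentially. AE \<omega> in M. \<omega> \<notin> B k n \<longrightarrow> Y n \<omega> \<in> J k (Z n \<omega>)"
  shows "converges_in_distribution M Y N (\<lambda>\<omega>. \<Psi> (Zlim \<omega>))"
proof -
  interpret M: prob_space M by (rule M)
  interpret N: prob_space N by (rule N)
  have Z: "Z n \<in> borel_measurable M" "Zlim \<in> borel_measurable N" for n
    using conv by (auto simp: converges_in_distribution_def)
  have upper: "\<forall>\<^sub>F n in sequentially. (\<integral>\<omega>. f (Y n \<omega>) \<partial>M) < (\<integral>\<omega>. f (\<Psi> (Zlim \<omega>)) \<partial>N) + e"
    if f: "continuous_on UNIV f" "bounded (range f)" and e: "e > 0" for f :: "'t \<Rightarrow> real" and e
  proof -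
    obtain C where "\<And>y. norm (f y) \<le> C" using f(2) unfolding bounded_iff by auto
    then have Cabs: "\<bar>f y\<bar> \<le> C" for y by simp
    then have C: "- C \<le> f y" "f y \<le> C" for y using abs_le_iff[of "f y" C] by (auto simp: minus_le_iff)
    have f\<Psi>: "continuous_on UNIV (\<lambda>z. f (\<Psi> z))"
      by (rule continuous_on_compose2[OF f(1) \<Psi>]) simp
    have "\<exists>H. (\<forall>k. continuous_on UNIV (H k)) \<and> (\<forall>k z. \<bar>H k z\<bar> \<le> C) \<and>
        (\<forall>k z. \<forall>y\<in>J k z. f y \<le> H k z) \<and> (\<forall>z. (\<lambda>k. H k z) \<longlonglongrightarrow> f (\<Psi> z))"
      by (rule upper_envelopes[of f C q \<Psi> J]; fact)
    then obtain H where H_cont: "\<And>k. continuous_on UNIV (H k)" and H_bound: "\<And>k z. \<bar>H k z\<bar> \<le> C"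
      and H_upper: "\<And>k z y. y \<in> J k z \<Longrightarrow> f y \<le> H k z"
      and H_lim: "\<And>z. (\<lambda>k. H k z) \<longlonglongrightarrow> f (\<Psi> z)"
      by blast
    have HN: "(\<lambda>\<omega>. H k (Zlim \<omega>)) \<in> borel_measurable N" for k
      using measurable_compose[OF Z(2) borel_measurable_continuous_onI[OF H_cont]] .
    have "(\<lambda>k. \<integral>\<omega>. H k (Zlim \<omega>) \<partial>N) \<longlonglongrightarrow> (\<integral>\<omega>. f (\<Psi> (Zlim \<omega>)) \<partial>N)"
    proof (rule integral_dominated_convergence[where w = "\<lambda>_. C"])
      show "(\<lambda>\<omega>. f (\<Psi> (Zlim \<omega>))) \<in> borel_measurable N"
        using measurable_compose[OF Z(2) borel_measurable_continuous_onI[OF f\<Psi>]] .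
    qed (use HN H_lim H_bound in auto)
    from order_tendstoD(2)[OF this, of "(\<integral>\<omega>. f (\<Psi> (Zlim \<omega>)) \<partial>N) + e / 3"] e
    obtain k where k: "(\<integral>\<omega>. H k (Zlim \<omega>) \<partial>N) < (\<integral>\<omega>. f (\<Psi> (Zlim \<omega>)) \<partial>N) + e / 3"
      unfolding eventually_sequentially by auto
    have "(\<lambda>n. \<integral>\<omega>. H k (Z n \<omega>) \<partial>M) \<longlonglongrightarrow> (\<integral>\<omega>. H k (Zlim \<omega>) \<partial>N)"
      using conv H_cont[of k] H_bound[of k] unfolding converges_in_distribution_def bounded_iff by auto
    from order_tendstoD(2)[OF this, of "(\<integral>\<omega>. H k (Zlim \<omega>) \<partial>N) + e / 3"] e
    have ev1: "\<forall>\<^sub>F n in sequentially. (\<integral>\<omega>. H k (Z n \<omega>) \<partial>M) < (\<integral>\<omega>. H k (Zlim \<omega>) \<partial>N) + e / 3" by simp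
    have "(\<lambda>n. 2 * C * measure M (B k n)) \<longlonglongrightarrow> 0"
      using B(2) by (rule tendsto_mult_right_zero)
    from order_tendstoD(2)[OF this, of "e / 3"] e
    have ev2: "\<forall>\<^sub>F n in sequentially. 2 * C * measure M (B k n) < e / 3" by simp
    show ?thesis
      using ev1 ev2 YJ[of k]
    proof eventually_elim
      case (elim n)
      have int_H: "integrable M (\<lambda>\<omega>. H k (Z n \<omega>))"
        using measurable_compose[OF Z(1) borel_measurable_continuous_onI[OF H_cont]] H_bound
        by (intro M.integrable_const_bound[of _ C]) auto
      have int_f: "integrable M (\<lambda>\<omega>. f (Y n \<omega>))"
        using measurable_compose[OF Y borel_measurable_continuous_onI[OF f(1)]] Cabs
        by (intro M.integrable_const_bound[of _ C]) auto
      have int_B: "integrable M (\<lambda>\<omega>. 2 * C * indicator (B k n) \<omega> :: real)"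
        using B(1) by (intro integrable_mult_right integrable_real_indicator) (auto simp: M.emeasure_eq_measure)
      have "(\<integral>\<omega>. f (Y n \<omega>) \<partial>M) \<le> (\<integral>\<omega>. H k (Z n \<omega>) + 2 * C * indicator (B k n) \<omega> \<partial>M)"
      proof (rule integral_mono_AE[OF int_f Bochner_Integration.integrable_add[OF int_H int_B]])
        show "AE \<omega> in M. f (Y n \<omega>) \<le> H k (Z n \<omega>) + 2 * C * indicator (B k n) \<omega>"
          using elim(3)
        proof eventually_elim
          case (elim \<omega>)
          show ?case
          proof (cases "\<omega> \<in> B k n")
            case True
            then show ?thesis using C(2)[of "Y n \<omega>"] H_bound[of k "Z n \<omega>"] by (simp add: abs_le_iff)
          next
            case False
            then show ?thesis using elim H_upper by simp
          qed
        qed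
      qed
      also have "\<dots> = (\<integral>\<omega>. H k (Z n \<omega>) \<partial>M) + 2 * C * measure M (B k n)"
        using int_H int_B B(1) by simp
      finally show ?case using elim(1,2) k by linarith
    qed
  qed
  show ?thesis
    unfolding converges_in_distribution_def
  proof (intro conjI allI impI)
    show "Y n \<in> borel_measurable M" for n by (rule Y)
    show "(\<lambda>\<omega>. \<Psi> (Zlim \<omega>)) \<in> borel_measurable N"
      by (rule measurable_compose[OF Z(2) borel_measurable_continuous_onI[OF \<Psi>]])
    fix f :: "'t \<Rightarrow> real"
    assume "continuous_on UNIV f \<and> bounded (range f)"
    then have f: "continuous_on UNIV f" "bounded (range f)" by auto
    then have mf: "continuous_on UNIV (\<lambda>y. - f y)" "bounded (range (\<lambda>y. - f y))"
      by (auto intro: continuous_on_minus simp: bounded_iff)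
    show "(\<lambda>n. \<integral>\<omega>. f (Y n \<omega>) \<partial>M) \<longlonglongrightarrow> (\<integral>\<omega>. f (\<Psi> (Zlim \<omega>)) \<partial>N)"
    proof (rule tendstoI)
      fix e :: real assume e: "e > 0"
      from upper[OF f e] upper[OF mf e]
      show "\<forall>\<^sub>F n in sequentially. dist (\<integral>\<omega>. f (Y n \<omega>) \<partial>M) (\<integral>\<omega>. f (\<Psi> (Zlim \<omega>)) \<partial>N) < e"
        by eventually_elim (simp add: dist_real_def abs_less_iff)
    qed
  qed
qed

section \<open>Fluctuations of the flow\<close>

text \<open>
  The rescaled path deviations whose data lie within \<open>1 / (k + 1)\<close> of the limit data and have the
  rescaled deviation \<open>z\<close>. The scale \<open>c\<close> is arbitrary. Closeness of the data is imposed separately, as it is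
  meant in the smaller space, whereas \<open>z\<close> lives in the larger one.
\<close>

definition fluctuations where
  "fluctuations \<iota> g x0 x k z = {y. \<exists>c \<xi> G X. data_dist k (x0, g) (\<xi>, G) < inverse (real (Suc k)) \<and>
    solves (apply_C0b G) \<xi> X \<and>
    z = (c *\<^sub>R \<iota> (\<xi> - x0), c *\<^sub>R C0b_map \<iota> (G - g)) \<and> y = c *\<^sub>R C1_map \<iota> (X - x)}"

lemma fluctuations_tendsto:
  fixes \<iota> :: "'e::banach \<Rightarrow> 'f::banach" and g :: "('e, 'e) C0b"
  assumes emb: "dense_embedding \<iota>" and g: "C1_via \<iota> (apply_C0b g)"
    and complete: "complete_field (apply_C0b g)" and x: "solves (apply_C0b g) x0 x"
    and F: "F \<le> sequentially" and w: "(w \<longlongrightarrow> z) F"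
    and y: "\<forall>\<^sub>F k in F. y k \<in> fluctuations \<iota> g x0 x k (w k)"
  shows "(y \<longlongrightarrow> linearised_flow \<iota> (apply_C0b g) x z) F"
proof -
  have "\<exists>c \<xi> G X. y k \<in> fluctuations \<iota> g x0 x k (w k) \<longrightarrow>
    data_dist k (x0, g) (\<xi>, G) < inverse (real (Suc k)) \<and> solves (apply_C0b G) \<xi> X \<and>
    w k = (c *\<^sub>R \<iota> (\<xi> - x0), c *\<^sub>R C0b_map \<iota> (G - g)) \<and> y k = c *\<^sub>R C1_map \<iota> (X - x)" for k
    unfolding fluctuations_def by blast
  then obtain c \<xi> G X where *: "\<And>k. y k \<in> fluctuations \<iota> g x0 x k (w k) \<longrightarrow>
    data_dist k (x0, g) (\<xi> k, G k) < inverse (real (Suc k)) \<and> solves (apply_C0b (G k)) (\<xi> k) (X k) \<and>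
    w k = (c k *\<^sub>R \<iota> (\<xi> k - x0), c k *\<^sub>R C0b_map \<iota> (G k - g)) \<and> y k = c k *\<^sub>R C1_map \<iota> (X k - x)"
    by metis
  from y have ev: "\<forall>\<^sub>F k in F. data_dist k (x0, g) (\<xi> k, G k) \<le> inverse (real (Suc k))"
    "\<forall>\<^sub>F k in F. solves (apply_C0b (G k)) (\<xi> k) (X k)"
    "\<forall>\<^sub>F k in F. fst (w k) = c k *\<^sub>R \<iota> (\<xi> k - x0)"
    "\<forall>\<^sub>F k in F. snd (w k) = c k *\<^sub>R C0b_map \<iota> (G k - g)"
    "\<forall>\<^sub>F k in F. c k *\<^sub>R C1_map \<iota> (X k - x) = y k"
    by (auto elim!: eventually_mono dest!: *[rule_format])
  have "((\<lambda>k. data_dist k (x0, g) (\<xi> k, G k)) \<longlongrightarrow> 0) F"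
    by (rule tendsto_sandwich[OF _ ev(1) tendsto_const tendsto_mono[OF F LIMSEQ_inverse_real_of_nat]])
      (simp add: data_dist_nonneg)
  then have data: "((\<lambda>k. (\<xi> k, G k)) \<longlongrightarrow> (x0, g)) F" by (rule tendsto_data_distI[OF F])
  have "((\<lambda>k. c k *\<^sub>R C1_map \<iota> (X k - x)) \<longlongrightarrow> linearised_flow \<iota> (apply_C0b g) x z) F"
  proof (rule flow_first_order[OF emb g _ x _ ev(2)])
    show "\<exists>u>0. \<exists>L. L-lipschitz_on (cball p u) (apply_C0b g)" for p
      using complete by (simp add: complete_field_def)
    show "solves_linearised \<iota> (apply_C0b g) x (fst z) (snd z) (linearised_flow \<iota> (apply_C0b g) x z)"
      by (rule solves_linearised_flow(1)[OF emb g])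
    show "(\<xi> \<longlongrightarrow> x0) F" "(G \<longlongrightarrow> g) F"
      using tendsto_fst[OF data] tendsto_snd[OF data] by simp_all
    show "((\<lambda>k. c k *\<^sub>R \<iota> (\<xi> k - x0)) \<longlongrightarrow> fst z) F"
      by (rule Lim_transform_eventually[OF tendsto_fst[OF w] ev(3)])
    show "((\<lambda>k. c k *\<^sub>R C0b_map \<iota> (G k - g)) \<longlongrightarrow> snd z) F"
      by (rule Lim_transform_eventually[OF tendsto_snd[OF w] ev(4)])
  qed
  then show ?thesis by (rule Lim_transform_eventually[OF _ ev(5)])
qed

section \<open>Measurability and Gaussian laws\<close>

text \<open>
  Even for a domain \<open>D\<close> that is not measurable, its relatively open sets are traces of open sets, so
  preimages under \<open>Y\<close> agree with measurable sets up to null sets.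
\<close>

lemma borel_measurable_completion_continuous_on:
  fixes w :: "'w \<Rightarrow> 's::topological_space" and \<Phi> :: "'s \<Rightarrow> 't::topological_space"
  assumes w: "w \<in> borel_measurable M" and \<Phi>: "continuous_on D \<Phi>"
    and Y: "AE \<omega> in M. w \<omega> \<in> D \<and> Y \<omega> = \<Phi> (w \<omega>)"
  shows "Y \<in> borel_measurable (completion M)"
proof (rule borel_measurableI)
  fix U :: "'t set" assume "open U"
  then obtain V where V: "open V" "V \<inter> D = \<Phi> -` U \<inter> D"
    using \<Phi> unfolding continuous_on_open_invariant by blast
  show "Y -` U \<inter> space (completion M) \<in> sets (completion M)"
  proof (rule completion.in_sets_AE)
    show "AE \<omega> in completion M. \<omega> \<in> w -` V \<inter> space M \<longleftrightarrow> \<omega> \<in> Y -` U \<inter> space (completion M)"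
      unfolding AE_completion_iff using Y AE_space
      by eventually_elim (use V(2) in auto)
    show "w -` V \<inter> space M \<in> sets (completion M)"
      using measurable_sets[OF w borel_open[OF V(1)]] by (rule sets_completionI_sets)
  qed simp
qed

lemma converges_in_distribution_completion:
  assumes "converges_in_distribution M Y N Z"
  shows "converges_in_distribution (completion M) Y N Z"
proof -
  have Y: "Y n \<in> borel_measurable M" for n using assms by (simp add: converges_in_distribution_def)
  have "(\<integral>\<omega>. f (Y n \<omega>) \<partial>completion M) = (\<integral>\<omega>. f (Y n \<omega>) \<partial>M)" if "continuous_on UNIV f"
    for f :: "_ \<Rightarrow> real" and n
    by (rule integral_completion[OF measurable_compose[OF Y borel_measurable_continuous_onI[OF that]]])
  then show ?thesis
    using assms Y by (auto simp: converges_in_distribution_def intro: measurable_completion)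
qed

lemma (in prob_space) prob_tendsto_0:
  assumes B: "\<And>n. B n \<in> sets M" and ev: "AE \<omega> in M. \<forall>\<^sub>F n in sequentially. \<omega> \<notin> B n"
  shows "(\<lambda>n. prob (B n)) \<longlonglongrightarrow> 0"
proof -
  have "(\<lambda>n. \<integral>\<omega>. indicator (B n) \<omega> \<partial>M) \<longlonglongrightarrow> (\<integral>\<omega>. 0 \<partial>M :: real)"
  proof (rule integral_dominated_convergence[where w = "\<lambda>_. 1"])
    show "AE \<omega> in M. (\<lambda>n. indicator (B n) \<omega> :: real) \<longlonglongrightarrow> 0"
      using ev
    proof eventually_elim
      case (elim \<omega>)
      then have "\<forall>\<^sub>F n in sequentially. 0 = (indicator (B n) \<omega> :: real)"
        by eventually_elim simp
      then show ?case by (rule Lim_transform_eventually[OF tendsto_const])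
    qed
  qed (use B in \<open>auto simp: indicator_def\<close>)
  then show ?thesis using B sets.sets_into_space by (simp add: Int_absorb2)
qed

lemma gaussian_linear_image:
  fixes \<Psi> :: "'s::{real_vector, topological_space} \<Rightarrow> 't::{real_vector, topological_space}"
  assumes Z: "gaussian N Z" and \<Psi>: "linear \<Psi>" "continuous_on UNIV \<Psi>"
  shows "gaussian N (\<lambda>\<omega>. \<Psi> (Z \<omega>))"
  unfolding gaussian_def
proof (intro conjI allI impI)
  show "(\<lambda>\<omega>. \<Psi> (Z \<omega>)) \<in> borel_measurable N"
    using Z by (intro measurable_compose[OF _ borel_measurable_continuous_onI[OF \<Psi>(2)]])
      (simp add: gaussian_def)
  fix l :: "'t \<Rightarrow> real" assume l: "linear l \<and> continuous_on UNIV l"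
  then have "linear (\<lambda>z. l (\<Psi> z))" using linear_compose[OF \<Psi>(1)] by (auto simp: o_def)
  moreover have "continuous_on UNIV (\<lambda>z. l (\<Psi> z))"
    by (rule continuous_on_compose2[OF conjunct2[OF l] \<Psi>(2)]) simp
  ultimately show "gaussian_real N (\<lambda>\<omega>. l (\<Psi> (Z \<omega>)))"
    using Z[unfolded gaussian_def, THEN conjunct2, rule_format, of "\<lambda>z. l (\<Psi> z)"] by simp
qed

section \<open>Almost sure convergence and Gaussian fluctuations of the solutions\<close>

theorem corollary2p3:
  fixes M :: "'w measure"
    and N :: "'v measure"
    and X0 :: "nat \<Rightarrow> 'w \<Rightarrow> 'e::banach"
    and G :: "nat \<Rightarrow> 'w \<Rightarrow> ('e, 'e) C0b"
    and X :: "nat \<Rightarrow> 'w \<Rightarrow> 'e C1"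
    and \<iota> :: "'e \<Rightarrow> 'f::banach"
  assumes "prob_space M"
    and "\<And>n. n \<ge> 1 \<Longrightarrow> X0 n \<in> borel_measurable M"
    and "\<And>n. n \<ge> 1 \<Longrightarrow> G n \<in> borel_measurable M"
    and "\<And>n. n \<ge> 1 \<Longrightarrow> AE \<omega> in M. complete_field (apply_C0b (G n \<omega>))"
    and "\<And>n. n \<ge> 1 \<Longrightarrow> AE \<omega> in M. solves (apply_C0b (G n \<omega>)) (X0 n \<omega>) (X n \<omega>)"
  shows
    "(\<forall>x0 g x.
        (AE \<omega> in M. (\<lambda>n. (X0 n \<omega>, G n \<omega>)) \<longlonglongrightarrow> (x0 \<omega>, g \<omega>)) \<and>
        (AE \<omega> in M. complete_field (apply_C0b (g \<omega>))) \<and>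
        (AE \<omega> in M. solves (apply_C0b (g \<omega>)) (x0 \<omega>) (x \<omega>))
        \<longrightarrow> (AE \<omega> in M. (\<lambda>n. X n \<omega>) \<longlonglongrightarrow> x \<omega>))
     \<and>
     (\<forall>x0 g x \<X>0 \<G>.
        (\<forall>n\<ge>1. (\<lambda>\<omega>. (X0 n \<omega>, G n \<omega>)) \<in> borel_measurable M) \<and>
        (AE \<omega> in M. (\<lambda>n. (X0 n \<omega>, G n \<omega>)) \<longlonglongrightarrow> (x0, g)) \<and>
        complete_field (apply_C0b g) \<and>
        solves (apply_C0b g) x0 x \<and>
        dense_embedding \<iota> \<and>
        C1_via \<iota> (apply_C0b g) \<and>
        prob_space N \<and>
        converges_in_distribution M
          (\<lambda>n \<omega>. (sqrt (real n) *\<^sub>R \<iota> (X0 n \<omega> - x0),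
                   sqrt (real n) *\<^sub>R C0b_map \<iota> (G n \<omega> - g)))
          N (\<lambda>\<omega>. (\<X>0 \<omega>, \<G> \<omega>)) \<and>
        gaussian N (\<lambda>\<omega>. (\<X>0 \<omega>, \<G> \<omega>))
        \<longrightarrow>
        (\<exists>\<X>.
          (\<forall>\<omega>\<in>space N.
             solves_linearised \<iota> (apply_C0b g) x (\<X>0 \<omega>) (\<G> \<omega>) (\<X> \<omega>) \<and>
             (\<forall>y. solves_linearised \<iota> (apply_C0b g) x (\<X>0 \<omega>) (\<G> \<omega>) y \<longrightarrow> y = \<X> \<omega>)) \<and>
          gaussian N \<X> \<and>
          converges_in_distribution (completion M)
            (\<lambda>n \<omega>. sqrt (real n) *\<^sub>R C1_map \<iota> (X n \<omega> - x)) N \<X>))"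
proof -
  interpret prob_space M by (rule assms(1))
  have complete_AE: "AE \<omega> in M. \<forall>n\<ge>1. complete_field (apply_C0b (G n \<omega>))"
    and solves_AE: "AE \<omega> in M. \<forall>n\<ge>1. solves (apply_C0b (G n \<omega>)) (X0 n \<omega>) (X n \<omega>)"
    using assms(4,5) by (auto simp: AE_all_countable)
  show ?thesis
  proof (intro conjI allI impI; elim conjE)
    fix x0 g x
    assume lim: "AE \<omega> in M. (\<lambda>n. (X0 n \<omega>, G n \<omega>)) \<longlonglongrightarrow> (x0 \<omega>, g \<omega>)"
      and complete: "AE \<omega> in M. complete_field (apply_C0b (g \<omega>))"
      and x: "AE \<omega> in M. solves (apply_C0b (g \<omega>)) (x0 \<omega>) (x \<omega>)"
    from lim complete x solves_AE show "AE \<omega> in M. (\<lambda>n. X n \<omega>) \<longlonglongrightarrow> x \<omega>"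
    proof eventually_elim
      case (elim \<omega>)
      have "\<forall>\<^sub>F n in sequentially. solves (apply_C0b (G n \<omega>)) (X0 n \<omega>) (X n \<omega>)"
        using elim(4) by (auto intro: eventually_sequentiallyI[of 1])
      then show ?case
        using elim(2,3) tendsto_fst[OF elim(1)] tendsto_snd[OF elim(1)]
        by (intro flow_stable[of "g \<omega>" "x0 \<omega>" _ "\<lambda>n. G n \<omega>" "\<lambda>n. X0 n \<omega>"])
          (simp_all add: complete_field_def)
    qed
  next
    fix x0 g x \<X>0 \<G>
    assume meas: "\<forall>n\<ge>1. (\<lambda>\<omega>. (X0 n \<omega>, G n \<omega>)) \<in> borel_measurable M"
      and lim: "AE \<omega> in M. (\<lambda>n. (X0 n \<omega>, G n \<omega>)) \<longlonglongrightarrow> (x0, g)"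
      and complete: "complete_field (apply_C0b g)"
      and x: "solves (apply_C0b g) x0 x"
      and emb: "dense_embedding \<iota>" and g: "C1_via \<iota> (apply_C0b g)"
      and N: "prob_space N"
      and conv: "converges_in_distribution M
          (\<lambda>n \<omega>. (sqrt (real n) *\<^sub>R \<iota> (X0 n \<omega> - x0),
                   sqrt (real n) *\<^sub>R C0b_map \<iota> (G n \<omega> - g)))
          N (\<lambda>\<omega>. (\<X>0 \<omega>, \<G> \<omega>))"
      and gauss: "gaussian N (\<lambda>\<omega>. (\<X>0 \<omega>, \<G> \<omega>))"
    have \<iota>: "bounded_linear \<iota>" by (rule dense_embedding_bounded_linear[OF emb])
    define \<Psi> where "\<Psi> = linearised_flow \<iota> (apply_C0b g) x"
    have \<Psi>: "linear \<Psi>" "continuous_on UNIV \<Psi>"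
      unfolding \<Psi>_def by (rule linear_linearised_flow[OF emb g] continuous_on_linearised_flow[OF emb g])+
    \<comment> \<open>The data are measurable random variables from index one on, hence the separate case.\<close>
    define B where "B k n = (if n = 0 then {} else
      {\<omega> \<in> space M. inverse (real (Suc k)) \<le> data_dist k (x0, g) (X0 n \<omega>, G n \<omega>)})" for k n
    have B: "B k n \<in> sets M" for k n
    proof (cases "n = 0")
      case False
      then have "(\<lambda>\<omega>. data_dist k (x0, g) (X0 n \<omega>, G n \<omega>)) \<in> borel_measurable M"
        using meas by (intro measurable_compose[OF _ borel_measurable_continuous_onI[OF continuous_on_data_dist]]) auto
      then show ?thesis using False by (simp add: B_def)
    qed (simp add: B_def)
    have "(\<lambda>n. prob (B k n)) \<longlonglongrightarrow> 0" for k
    proof (rule prob_tendsto_0[OF B])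
      show "AE \<omega> in M. \<forall>\<^sub>F n in sequentially. \<omega> \<notin> B k n"
        using lim
      proof eventually_elim
        case (elim \<omega>)
        have "((\<lambda>n. data_dist k (x0, g) (X0 n \<omega>, G n \<omega>)) \<longlongrightarrow> 0) sequentially"
          by (rule filterlim_compose[OF data_dist_tendsto_0 elim])
        from order_tendstoD(2)[OF this, of "inverse (real (Suc k))"]
        have "\<forall>\<^sub>F n in sequentially. data_dist k (x0, g) (X0 n \<omega>, G n \<omega>) < inverse (real (Suc k))"
          by simp
        then show ?case by eventually_elim (auto simp: B_def)
      qed
    qed
    then have B_lim: "(\<lambda>n. measure (completion M) (B k n)) \<longlonglongrightarrow> 0" for k
      using B by (simp add: measure_completion)
    have Y: "(\<lambda>\<omega>. sqrt (real n) *\<^sub>R C1_map \<iota> (X n \<omega> - x)) \<in> borel_measurable (completion M)" for n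
    proof (cases "n = 0")
      case False
      then have n: "n \<ge> 1" by simp
      have "X n \<in> borel_measurable (completion M)"
      proof (rule borel_measurable_completion_continuous_on[OF meas[rule_format, OF n] continuous_on_flow])
        show "AE \<omega> in M. (X0 n \<omega>, G n \<omega>) \<in> {z. complete_field (apply_C0b (snd z))} \<and>
            X n \<omega> = flow (X0 n \<omega>, G n \<omega>)"
          using complete_AE solves_AE
          by eventually_elim (use n solves_flow(2)[of "(X0 n \<omega>, G n \<omega>)" for \<omega>] in auto)
      qed
      moreover have "continuous_on UNIV (\<lambda>X. sqrt (real n) *\<^sub>R C1_map \<iota> (X - x))"
        unfolding continuous_on_def by (intro ballI scaled_C1_map_diff_tendsto[OF \<iota>] tendsto_ident_at)
      ultimately show ?thesis
        by (rule measurable_compose[OF _ borel_measurable_continuous_onI])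
    qed simp
    have "AE \<omega> in completion M. \<omega> \<notin> B k n \<longrightarrow> sqrt (real n) *\<^sub>R C1_map \<iota> (X n \<omega> - x) \<in>
        fluctuations \<iota> g x0 x k
          (sqrt (real n) *\<^sub>R \<iota> (X0 n \<omega> - x0), sqrt (real n) *\<^sub>R C0b_map \<iota> (G n \<omega> - g))"
      if n: "n \<ge> 1" for k n
      unfolding AE_completion_iff using solves_AE AE_space
    proof eventually_elim
      case (elim \<omega>)
      show ?case
      proof
        assume "\<omega> \<notin> B k n"
        then have "data_dist k (x0, g) (X0 n \<omega>, G n \<omega>) < inverse (real (Suc k))"
          using n elim(2) by (auto simp: B_def not_le)
        then show "sqrt (real n) *\<^sub>R C1_map \<iota> (X n \<omega> - x) \<in> fluctuations \<iota> g x0 x k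
            (sqrt (real n) *\<^sub>R \<iota> (X0 n \<omega> - x0), sqrt (real n) *\<^sub>R C0b_map \<iota> (G n \<omega> - g))"
          unfolding fluctuations_def using elim(1) n by blast
      qed
    qed
    then have YJ: "\<forall>\<^sub>F n in sequentially. AE \<omega> in completion M. \<omega> \<notin> B k n \<longrightarrow>
        sqrt (real n) *\<^sub>R C1_map \<iota> (X n \<omega> - x) \<in> fluctuations \<iota> g x0 x k
          (sqrt (real n) *\<^sub>R \<iota> (X0 n \<omega> - x0), sqrt (real n) *\<^sub>R C0b_map \<iota> (G n \<omega> - g))" for k
      by (intro eventually_sequentiallyI[of 1]) blast
    have "converges_in_distribution (completion M) (\<lambda>n \<omega>. sqrt (real n) *\<^sub>R C1_map \<iota> (X n \<omega> - x)) N
        (\<lambda>\<omega>. \<Psi> (\<X>0 \<omega>, \<G> \<omega>))"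
    proof (rule extended_continuous_mapping[where q = data_dist and J = "fluctuations \<iota> g x0 x" and B = B])
      show "prob_space (completion M)" by (rule prob_space_completion)
      show "(y \<longlongrightarrow> \<Psi> z) F" if "F \<le> sequentially" "(w \<longlongrightarrow> z) F"
        "\<forall>\<^sub>F k in F. y k \<in> fluctuations \<iota> g x0 x k (w k)" for F z w y
        unfolding \<Psi>_def by (rule fluctuations_tendsto[OF emb g complete x that])
    qed (fact N converges_in_distribution_completion[OF conv] \<Psi>(2) Y sets_completionI_sets[OF B] B_lim YJ
      data_dist_nonneg data_dist_self data_dist_commute data_dist_triangle
      data_dist_tendsto_0 | rule tendsto_data_distI, assumption+)+
    moreover have "gaussian N (\<lambda>\<omega>. \<Psi> (\<X>0 \<omega>, \<G> \<omega>))"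
      by (rule gaussian_linear_image[OF gauss \<Psi>])
    moreover have "solves_linearised \<iota> (apply_C0b g) x (\<X>0 \<omega>) (\<G> \<omega>) (\<Psi> (\<X>0 \<omega>, \<G> \<omega>)) \<and>
        (\<forall>y. solves_linearised \<iota> (apply_C0b g) x (\<X>0 \<omega>) (\<G> \<omega>) y \<longrightarrow> y = \<Psi> (\<X>0 \<omega>, \<G> \<omega>))" for \<omega>
    proof (intro conjI allI impI)
      note sol = solves_linearised_flow[OF emb g, of x "(\<X>0 \<omega>, \<G> \<omega>)", unfolded fst_conv snd_conv,
        folded \<Psi>_def]
      show "solves_linearised \<iota> (apply_C0b g) x (\<X>0 \<omega>) (\<G> \<omega>) (\<Psi> (\<X>0 \<omega>, \<G> \<omega>))" by (rule sol(1))
      show "y = \<Psi> (\<X>0 \<omega>, \<G> \<omega>)" if "solves_linearised \<iota> (apply_C0b g) x (\<X>0 \<omega>) (\<G> \<omega>) y" for y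
        using that by (rule sol(2))
    qed
    ultimately show "\<exists>\<X>.
          (\<forall>\<omega>\<in>space N.
             solves_linearised \<iota> (apply_C0b g) x (\<X>0 \<omega>) (\<G> \<omega>) (\<X> \<omega>) \<and>
             (\<forall>y. solves_linearised \<iota> (apply_C0b g) x (\<X>0 \<omega>) (\<G> \<omega>) y \<longrightarrow> y = \<X> \<omega>)) \<and>
          gaussian N \<X> \<and>
          converges_in_distribution (completion M)
            (\<lambda>n \<omega>. sqrt (real n) *\<^sub>R C1_map \<iota> (X n \<omega> - x)) N \<X>"
      by (intro exI[of _ "\<lambda>\<omega>. \<Psi> (\<X>0 \<omega>, \<G> \<omega>)"]) blast
  qed
qed

end
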